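(* Let $\mathcal{X}$ be a Banach space with a fundamental biorthogonal system. Then densely many norms on $\mathcal{X}$ are $C^\infty$-smooth and LFC on a dense open subset of $\mathcal{X}$. That is: for every equivalent norm $\|\cdot\|$ on $\mathcal{X}$ and every $\varepsilon>0$ there are an equivalent norm $|||\cdot|||$ on $\mathcal{X}$ and a dense open subset $U$ of $\mathcal{X}$ such that $(1-\varepsilon)|||\cdot|||\le\|\cdot\|\le(1+\varepsilon)|||\cdot|||$ and $|||\cdot|||$ is $C^\infty$-smooth and LFC on $U$.
   Context: All normed spaces are over the reals, and $\mathcal{X}$ is infinite-dimensional. A biorthogonal system in $\mathcal{X}$ is a system $\{e_\alpha;\varphi_\alpha\}_{\alpha\in\Gamma}$ with $e_\alpha\in\mathcal{X}$, $\varphi_\alpha\in\mathcal{X}^*$ and $\langle\varphi_\alpha,e_\beta\rangle=\delta_{\alpha,\beta}$ for all $\alpha,\beta\in\Gamma$; it is fundamental if $\mathrm{span}\{e_\alpha\}_{\alpha\in\Gamma}$ is dense in $\mathcal{X}$. A norm on $\mathcal{X}$ is $C^\infty$-smooth on an open set $U$ if it has continuous Fréchet derivatives of all orders at every point of $U$. A norm $|||\cdot|||$ is LFC (locally depends on finitely many coordinates) on an open set $U$ if for each $x\in U$ there are an open neighbourhood $V\subseteq U$ of $x$ and functionals $\psi_1,\dots,\psi_k\in\mathcal{X}^*$ such that $|||y|||=|||z|||$ for all $y,z\in V$ with $\langle\psi_j,y\rangle=\langle\psi_j,z\rangle$ for $j=1,\dots,k$. *)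

theory Defs
  imports "HOL-Analysis.Analysis"
begin

definition is_norm :: "('a::real_vector \<Rightarrow> real) \<Rightarrow> bool" where
  "is_norm N \<longleftrightarrow>
     (\<forall>x. 0 \<le> N x) \<and> (\<forall>x. N x = 0 \<longleftrightarrow> x = 0) \<and>
     (\<forall>c x. N (c *\<^sub>R x) = \<bar>c\<bar> * N x) \<and> (\<forall>x y. N (x + y) \<le> N x + N y)"

definition equivalent_norm :: "('a::real_normed_vector \<Rightarrow> real) \<Rightarrow> bool" where
  "equivalent_norm N \<longleftrightarrow>
     is_norm N \<and> (\<exists>a>0. \<exists>b>0. \<forall>x. a * norm x \<le> N x \<and> N x \<le> b * norm x)"

definition biorthogonal_system ::
  "'i set \<Rightarrow> ('i \<Rightarrow> 'a::real_normed_vector) \<Rightarrow> ('i \<Rightarrow> 'a \<Rightarrow>\<^sub>L real) \<Rightarrow> bool" where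
  "biorthogonal_system \<Gamma> e \<phi> \<longleftrightarrow>
     (\<forall>\<alpha>\<in>\<Gamma>. \<forall>\<beta>\<in>\<Gamma>. blinfun_apply (\<phi> \<alpha>) (e \<beta>) = (if \<alpha> = \<beta> then 1 else 0))"

definition fundamental_biorthogonal_system ::
  "'i set \<Rightarrow> ('i \<Rightarrow> 'a::real_normed_vector) \<Rightarrow> ('i \<Rightarrow> 'a \<Rightarrow>\<^sub>L real) \<Rightarrow> bool" where
  "fundamental_biorthogonal_system \<Gamma> e \<phi> \<longleftrightarrow>
     biorthogonal_system \<Gamma> e \<phi> \<and> closure (span (e ` \<Gamma>)) = UNIV"

text \<open>
  The space of \<open>k\<close>-fold iterated bounded linear maps depends on \<open>k\<close> as a type.  It is therefore
  represented by the isometric space of bounded \<open>k\<close>-linear maps, and these by functions on lists,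
  of which only the values at lists of length \<open>k\<close> matter.
\<close>

definition bounded_multilinear ::
  "nat \<Rightarrow> ('a::real_normed_vector list \<Rightarrow> 'b::real_normed_vector) \<Rightarrow> bool" where
  "bounded_multilinear k T \<longleftrightarrow>
     (\<forall>us vs. length us + Suc (length vs) = k \<longrightarrow> linear (\<lambda>v. T (us @ v # vs))) \<and>
     (\<exists>K. \<forall>vs. length vs = k \<longrightarrow> norm (T vs) \<le> K * prod_list (map norm vs))"

definition multilinear_norm ::
  "nat \<Rightarrow> ('a::real_normed_vector list \<Rightarrow> 'b::real_normed_vector) \<Rightarrow> real" where
  "multilinear_norm k T =
     (SUP vs\<in>{vs. length vs = k \<and> (\<forall>v\<in>set vs. norm v \<le> 1)}. norm (T vs))"

text \<open>
  \<open>D k x\<close> is the \<open>k\<close>-th Frechet derivative of \<open>f\<close> at \<open>x\<close>: the map \<open>D k\<close> into the normed space of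
  bounded \<open>k\<close>-linear maps is Frechet differentiable at every \<open>x \<in> U\<close>, with derivative
  \<open>h \<mapsto> (vs \<mapsto> D (Suc k) x (h # vs))\<close>.  Differentiability and continuity are with respect to the
  operator norm, not pointwise in \<open>vs\<close>.  The definition is meant for open \<open>U\<close>.
\<close>

definition C_infinity_on ::
  "'a::real_normed_vector set \<Rightarrow> ('a \<Rightarrow> 'b::real_normed_vector) \<Rightarrow> bool" where
  "C_infinity_on U f \<longleftrightarrow>
     (\<exists>D :: nat \<Rightarrow> 'a \<Rightarrow> 'a list \<Rightarrow> 'b.
        (\<forall>x\<in>U. D 0 x [] = f x) \<and>
        (\<forall>k. \<forall>x\<in>U.
           bounded_multilinear k (D k x) \<and>
           ((\<lambda>y. multilinear_norm k (\<lambda>vs. D k y vs - D k x vs)) \<longlongrightarrow> 0) (at x) \<and>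
           ((\<lambda>y. multilinear_norm k (\<lambda>vs. D k y vs - D k x vs - D (Suc k) x ((y - x) # vs))
                   / norm (y - x)) \<longlongrightarrow> 0) (at x)))"

definition LFC_on :: "'a::real_normed_vector set \<Rightarrow> ('a \<Rightarrow> real) \<Rightarrow> bool" where
  "LFC_on U N \<longleftrightarrow>
     (\<forall>x\<in>U. \<exists>V. open V \<and> x \<in> V \<and> V \<subseteq> U \<and>
        (\<exists>\<Psi> :: ('a \<Rightarrow>\<^sub>L real) set. finite \<Psi> \<and>
           (\<forall>y\<in>V. \<forall>z\<in>V.
              (\<forall>\<psi>\<in>\<Psi>. blinfun_apply \<psi> y = blinfun_apply \<psi> z) \<longrightarrow> N y = N z)))"

end

theory Submission
  imports Defs
begin

text \<open>
  A norm that is equal to one bounded functional near each point of an open set is there both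
  \<open>C\<^sup>\<infinity>\<close>-smooth and locally dependent on one coordinate.  The norm constructed here has this
  property on a dense open set: densely, its unit sphere consists of flat facets.

  The facets come from cutting off caps.  If \<open>h\<close> is a functional with \<open>h \<le> (1 + \<kappa>) p\<close>, passing from
  the norm \<open>p\<close> to \<open>max p \<bar>h\<bar>\<close> removes from the unit ball of \<open>p\<close> two opposite caps and leaves facets
  in their place; the new norm is \<open>\<bar>h\<bar>\<close> on the open cone \<open>{p < \<bar>h\<bar>}\<close>.  For a maximal family of
  functionals whose cones are disjoint, all caps can be cut off at once without interfering
  (\<open>locally_linear_norm_if_small_excess_cones\<close>).  If every nonempty open set contains, up to
  scaling, such a cone, then the union of the cones of a maximal family is dense.

  It remains to find, arbitrarily close to the given norm \<open>N\<close>, a norm \<open>p\<close> with small caps around a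
  dense set of directions, that is, with densely many denting points on its sphere.  This is where
  the biorthogonal system enters.  Normalize it to \<open>\<parallel>\<phi>\<^sub>\<alpha>\<parallel> \<le> 1\<close>, write \<open>P\<^sub>A x\<close> for
  \<open>\<Sum>\<alpha>\<in>A. \<phi>\<^sub>\<alpha>(x) e\<^sub>\<alpha>\<close>, and let \<open>Q\<^sub>k x\<close> be the supremum, over the sets \<open>A\<close> of at most \<open>k\<close>
  indices, of a small multiple of \<open>\<parallel>x - P\<^sub>A x\<parallel>\<close> plus the Euclidean norm of the coordinates in \<open>A\<close>.
  Let \<open>y\<close> be in the span of the system, with support \<open>A\<close>.  For large \<open>k\<close> the set \<open>A\<close> attains the
  supremum at \<open>y\<close>: a set missing a point of \<open>A\<close> loses a fixed amount of the Euclidean part, and its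
  residual part has a weight at most \<open>1 / (k + 1)\<close>.  A functional \<open>q\<close> on the coordinates in \<open>A\<close>
  supports the Euclidean norm, hence \<open>Q\<^sub>k\<close>, at \<open>y\<close>, and if \<open>x\<close> is bounded with \<open>Q\<^sub>k x - q x\<close> small,
  then \<open>\<parallel>x - P\<^sub>A x\<parallel>\<close> is small and the coordinates of \<open>x\<close> in \<open>A\<close> are almost proportional to those of
  \<open>y\<close>; so \<open>x\<close> is close to the ray through \<open>y\<close> (\<open>envelope_exposes_ray\<close>).

  Now \<open>p\<close> is \<open>N\<close> plus a small convergent combination of all the \<open>Q\<^sub>k\<close>.  Given \<open>y\<close> and its \<open>k\<close>, split
  \<open>p = R + c Q\<^sub>k\<close> and add to \<open>c q\<close> a functional supporting the seminorm \<open>R\<close> at \<open>y\<close>, which exists by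
  the Hahn-Banach theorem.  The sum \<open>g\<close> supports \<open>p\<close> at \<open>y\<close>, and \<open>p x - g x\<close> bounds
  \<open>c (Q\<^sub>k x - q x)\<close>, so a slight multiple \<open>(1 + \<sigma>) g\<close> cuts off a small cap around \<open>y\<close>
  (\<open>small_excess_cone\<close>).
\<close>

section \<open>Functionals supporting a sublinear function\<close>

definition sublinear :: "('a::real_vector \<Rightarrow> real) \<Rightarrow> bool" where
  "sublinear p \<longleftrightarrow> (\<forall>x y. p (x + y) \<le> p x + p y) \<and> (\<forall>c\<ge>0. \<forall>x. p (c *\<^sub>R x) = c * p x)"

lemma sublinearI:
  assumes "\<And>x y. p (x + y) \<le> p x + p y" and "\<And>c x. 0 < c \<Longrightarrow> p (c *\<^sub>R x) = c * p x" and "p 0 = 0"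
  shows "sublinear p"
  unfolding sublinear_def
proof (intro conjI allI impI)
  fix c :: real and x assume "0 \<le> c"
  then show "p (c *\<^sub>R x) = c * p x"
    using assms(2)[of c x] assms(3) by (cases "c = 0") auto
qed (rule assms(1))

lemma sublinear_add: "sublinear p \<Longrightarrow> p (x + y) \<le> p x + p y"
  and sublinear_scale: "sublinear p \<Longrightarrow> 0 \<le> c \<Longrightarrow> p (c *\<^sub>R x) = c * p x"
  by (auto simp: sublinear_def)

lemma sublinear_zero: "sublinear p \<Longrightarrow> p 0 = 0"
  using sublinear_scale[of p 0 0] by simp

lemma sublinear_neg: "sublinear p \<Longrightarrow> - p (- x) \<le> p x"
  using sublinear_add[of p x "- x"] sublinear_zero[of p] by simp

text \<open>
  With \<open>s = 1 / t\<close> the terms are the difference quotients \<open>(p (y + s x) - p y) / s\<close>, which decrease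
  as \<open>s\<close> tends to \<open>0\<close>: this is the one-sided directional derivative of \<open>p\<close> at \<open>y\<close> in
  direction \<open>x\<close>.  The form used here avoids limits and divisions.
\<close>

definition directional_derivative :: "('a::real_vector \<Rightarrow> real) \<Rightarrow> 'a \<Rightarrow> 'a \<Rightarrow> real" where
  "directional_derivative p y x = (INF t\<in>{0..}. p (x + t *\<^sub>R y) - t * p y)"

lemma directional_derivative_below:
  assumes p: "sublinear p" and t: "0 \<le> t"
  shows "- p (- x) \<le> p (x + t *\<^sub>R y) - t * p y"
proof -
  have "t * p y = p ((x + t *\<^sub>R y) + - x)" using sublinear_scale[OF p t] by simp
  also have "\<dots> \<le> p (x + t *\<^sub>R y) + p (- x)" by (rule sublinear_add[OF p])
  finally show ?thesis by simp
qed

lemma directional_derivative_le: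
  assumes p: "sublinear p" and t: "0 \<le> t"
  shows "directional_derivative p y x \<le> p (x + t *\<^sub>R y) - t * p y"
  unfolding directional_derivative_def
  by (rule cINF_lower) (use directional_derivative_below[OF p] t in \<open>auto intro!: bdd_belowI2\<close>)

lemma directional_derivative_greatest:
  assumes "\<And>t. 0 \<le> t \<Longrightarrow> m \<le> p (x + t *\<^sub>R y) - t * p y"
  shows "m \<le> directional_derivative p y x"
  unfolding directional_derivative_def by (rule cINF_greatest) (use assms in auto)

lemma sublinear_directional_derivative:
  assumes p: "sublinear p"
  shows "sublinear (directional_derivative p y)"
proof (rule sublinearI)
  fix x z
  have *: "directional_derivative p y (x + z) - (p (z + u *\<^sub>R y) - u * p y) \<le> p (x + t *\<^sub>R y) - t * p y"
    if "0 \<le> t" "0 \<le> u" for t u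
  proof -
    have "directional_derivative p y (x + z) \<le> p ((x + z) + (t + u) *\<^sub>R y) - (t + u) * p y"
      using that by (intro directional_derivative_le[OF p]) auto
    moreover have "(x + z) + (t + u) *\<^sub>R y = (x + t *\<^sub>R y) + (z + u *\<^sub>R y)"
      by (simp add: algebra_simps)
    ultimately show ?thesis
      using sublinear_add[OF p, of "x + t *\<^sub>R y" "z + u *\<^sub>R y"] by (simp add: algebra_simps)
  qed
  have "directional_derivative p y (x + z) - (p (z + u *\<^sub>R y) - u * p y) \<le> directional_derivative p y x" if "0 \<le> u" for u
    using * that by (intro directional_derivative_greatest) auto
  then have "directional_derivative p y (x + z) - directional_derivative p y x \<le> directional_derivative p y z"
    by (intro directional_derivative_greatest) (fastforce simp: algebra_simps)
  then show "directional_derivative p y (x + z) \<le> directional_derivative p y x + directional_derivative p y z" by simp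
next
  have ge: "c * directional_derivative p y x \<le> directional_derivative p y (c *\<^sub>R x)" if c: "0 < c" for c x
  proof (rule directional_derivative_greatest)
    fix t :: real assume t: "0 \<le> t"
    have "c *\<^sub>R (x + (t / c) *\<^sub>R y) = c *\<^sub>R x + t *\<^sub>R y"
      using c by (simp add: scaleR_add_right)
    then have "c * p (x + (t / c) *\<^sub>R y) = p (c *\<^sub>R x + t *\<^sub>R y)"
      using c sublinear_scale[OF p, of c "x + (t / c) *\<^sub>R y"] by simp
    moreover have "c * directional_derivative p y x \<le> c * (p (x + (t / c) *\<^sub>R y) - (t / c) * p y)"
      using c t directional_derivative_le[OF p, of "t / c" y x] by (intro mult_left_mono) auto
    ultimately show "c * directional_derivative p y x \<le> p (c *\<^sub>R x + t *\<^sub>R y) - t * p y"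
      using c by (simp add: right_diff_distrib)
  qed
  fix c :: real and x assume c: "0 < c"
  have "(1 / c) * directional_derivative p y (c *\<^sub>R x) \<le> directional_derivative p y ((1 / c) *\<^sub>R c *\<^sub>R x)"
    using c by (intro ge) auto
  then have "directional_derivative p y (c *\<^sub>R x) \<le> c * directional_derivative p y x"
    using c by (simp add: field_simps)
  with ge[OF c, of x] show "directional_derivative p y (c *\<^sub>R x) = c * directional_derivative p y x" by simp
next
  have "0 \<le> directional_derivative p y 0"
    using sublinear_scale[OF p] by (intro directional_derivative_greatest) auto
  moreover have "directional_derivative p y 0 \<le> 0"
    using directional_derivative_le[OF p, of 0 y 0] sublinear_zero[OF p] by simp
  ultimately show "directional_derivative p y 0 = 0" by simp
qed

lemma sublinear_Inf_chain:
  assumes sub: "\<And>q. q \<in> C \<Longrightarrow> sublinear q \<and> (\<forall>x. q x \<le> p x)" and ne: "C \<noteq> {}"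
    and chain: "\<And>q r. q \<in> C \<Longrightarrow> r \<in> C \<Longrightarrow> (\<forall>x. q x \<le> r x) \<or> (\<forall>x. r x \<le> q x)"
  shows "sublinear (\<lambda>x. INF q\<in>C. q x) \<and> (\<forall>q\<in>C. \<forall>x. (INF q\<in>C. q x) \<le> q x)"
proof -
  let ?i = "\<lambda>x. INF q\<in>C. q x"
  have "- p (- x) \<le> q x" if "q \<in> C" for q x
  proof -
    have "- q (- x) \<le> q x" "q (- x) \<le> p (- x)" using sub[OF that] sublinear_neg by auto
    then show ?thesis by linarith
  qed
  then have bdd: "bdd_below ((\<lambda>q. q x) ` C)" for x by (auto intro!: bdd_belowI2)
  have low: "?i x \<le> q x" if "q \<in> C" for q x using that bdd by (intro cINF_lower)
  have great: "m \<le> ?i x" if "\<And>q. q \<in> C \<Longrightarrow> m \<le> q x" for m x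
    using that ne by (intro cINF_greatest) auto
  have "sublinear ?i"
  proof (rule sublinearI)
    fix x y
    have *: "?i (x + y) - r y \<le> q x" if q: "q \<in> C" and r: "r \<in> C" for q r
    proof -
      obtain s where s: "s \<in> C" "s x \<le> q x" "s y \<le> r y"
        using chain[OF q r] q r by blast
      have "?i (x + y) \<le> s (x + y)" using s by (intro low)
      also have "\<dots> \<le> s x + s y" using sub[OF s(1)] sublinear_add by blast
      finally show ?thesis using s by simp
    qed
    have "?i (x + y) - r y \<le> ?i x" if "r \<in> C" for r using * that by (intro great) auto
    then have "?i (x + y) - ?i x \<le> ?i y" by (intro great) (fastforce simp: algebra_simps)
    then show "?i (x + y) \<le> ?i x + ?i y" by simp
  next
    have ge: "c * ?i x \<le> ?i (c *\<^sub>R x)" if "0 < c" for c x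
    proof (rule great)
      fix q assume "q \<in> C"
      then show "c * ?i x \<le> q (c *\<^sub>R x)"
        using sub sublinear_scale[of q c x] low[of q x] that by simp
    qed
    fix c :: real and x assume c: "0 < c"
    have "(1 / c) * ?i (c *\<^sub>R x) \<le> ?i ((1 / c) *\<^sub>R c *\<^sub>R x)" using c by (intro ge) auto
    then have "?i (c *\<^sub>R x) \<le> c * ?i x" using c by (simp add: field_simps)
    with ge[OF c, of x] show "?i (c *\<^sub>R x) = c * ?i x" by simp
  next
    have "q 0 = 0" if "q \<in> C" for q using sub[OF that] sublinear_zero by blast
    then have "(\<lambda>q. q 0) ` C = {0}" using ne by force
    then show "?i 0 = 0" by simp
  qed
  with low show ?thesis by blast
qed

text \<open>
  The directional derivative of \<open>q\<close> at any point \<open>y\<close> is sublinear and below \<open>q\<close>, so by minimality it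
  is \<open>q\<close>.  For \<open>t = 1\<close> this says \<open>q x \<le> q (x + y) - q y\<close>, the missing half of additivity.
\<close>

lemma minimal_sublinear_linear:
  assumes q: "sublinear q"
    and minimal: "\<And>r. sublinear r \<Longrightarrow> (\<And>x. r x \<le> q x) \<Longrightarrow> r = q"
  shows "linear q"
proof -
  have eq: "directional_derivative q y = q" for y
    using directional_derivative_le[OF q, of 0 y] by (intro minimal sublinear_directional_derivative q) auto
  have add: "q (x + y) = q x + q y" for x y
    using directional_derivative_le[OF q, of 1 y x] sublinear_add[OF q, of x y] by (simp add: eq)
  have neg: "q (- x) = - q x" for x
    using add[of x "- x"] sublinear_zero[OF q] by simp
  have "q (c *\<^sub>R x) = c * q x" for c x
    using sublinear_scale[OF q, of c x] sublinear_scale[OF q, of "- c" x] neg[of "c *\<^sub>R x"]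
    by (cases "0 \<le> c") auto
  with add show ?thesis by (simp add: linear_iff)
qed

text \<open>
  The Hahn-Banach theorem in the form needed for support functionals.  A minimal sublinear function
  is chosen below the directional derivative of \<open>p\<close> at \<open>y\<close> instead of below \<open>p\<close>: this derivative is
  at most \<open>- p y\<close> in direction \<open>- y\<close>, so the resulting linear function is at least \<open>p y\<close> at \<open>y\<close>.
\<close>

lemma sublinear_supporting_functional:
  assumes p: "sublinear p"
  obtains f where "linear f" and "\<And>x. f x \<le> p x" and "f y = p y"
proof -
  let ?p = "directional_derivative p y"
  let ?S = "{q. sublinear q \<and> (\<forall>x. q x \<le> ?p x)}"
  \<comment> \<open>Zorn yields maximal elements, so the pointwise order is reversed.\<close>
  let ?ge = "\<lambda>q r::'a \<Rightarrow> real. \<forall>x. r x \<le> q x"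
  have "\<exists>q\<in>?S. \<forall>r\<in>?S. ?ge q r \<longrightarrow> r = q"
  proof (rule predicate_Zorn)
    show "partial_order_on ?S (relation_of ?ge ?S)"
    proof (rule partial_order_on_relation_ofI)
      fix q r s :: "'a \<Rightarrow> real"
      show "?ge q s" if "?ge q r" "?ge r s" using that by (meson order_trans)
      show "q = r" if "?ge q r" "?ge r q" using that by (intro ext antisym) auto
    qed simp
  next
    fix C assume "C \<in> Chains (relation_of ?ge ?S)"
    then have C: "C \<subseteq> ?S" "\<And>q r. q \<in> C \<Longrightarrow> r \<in> C \<Longrightarrow> ?ge q r \<or> ?ge r q"
      unfolding Chains_def relation_of_def by auto
    show "\<exists>u\<in>?S. \<forall>q\<in>C. ?ge q u"
    proof (cases "C = {}")
      case True
      then show ?thesis using sublinear_directional_derivative[OF p, of y] by auto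
    next
      case False
      then obtain q where q: "q \<in> C" by blast
      have i: "sublinear (\<lambda>x. INF q\<in>C. q x) \<and> (\<forall>q\<in>C. \<forall>x. (INF q\<in>C. q x) \<le> q x)"
        using C by (intro sublinear_Inf_chain[OF _ False, where p = ?p]) blast+
      then have "(\<lambda>x. INF q\<in>C. q x) \<in> ?S"
      proof -
        have "(INF q\<in>C. q x) \<le> q x" "q x \<le> ?p x" for x using i q C(1) by blast+
        then have "(INF q\<in>C. q x) \<le> ?p x" for x by (rule order_trans)
        with i show ?thesis by blast
      qed
      with i show ?thesis by (intro bexI[of _ "\<lambda>x. INF q\<in>C. q x"]) auto
    qed
  qed
  then obtain f where f: "sublinear f" "\<And>x. f x \<le> ?p x"
      and min: "\<And>r. r \<in> ?S \<Longrightarrow> ?ge f r \<Longrightarrow> r = f" by blast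
  have lin: "linear f"
  proof (rule minimal_sublinear_linear[OF f(1)])
    fix r assume r: "sublinear r" "\<And>x. r x \<le> f x"
    have "r x \<le> ?p x" for x using r(2) f(2) by (rule order_trans)
    with r show "r = f" by (intro min) auto
  qed
  have le: "f x \<le> p x" for x
    using f(2)[of x] directional_derivative_le[OF p, of 0 y x] by simp
  have "f (- y) \<le> - p y"
    using f(2)[of "- y"] directional_derivative_le[OF p, of 1 y "- y"] sublinear_zero[OF p] by simp
  then have "f y = p y" using le[of y] linear_neg[OF lin, of y] by simp
  with lin le show thesis by (rule that)
qed

section \<open>Locally linear functions\<close>

lemma multilinear_norm_zero:
  assumes "\<And>vs. length vs = k \<Longrightarrow> T vs = 0"
  shows "multilinear_norm k T = 0"
proof -
  let ?V = "{vs :: 'a list. length vs = k \<and> (\<forall>v\<in>set vs. norm v \<le> 1)}"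
  have "replicate k 0 \<in> ?V" by simp
  then have "(\<lambda>vs. norm (T vs)) ` ?V = (\<lambda>_. 0) ` ?V"
    by (intro image_cong) (auto simp: assms)
  also have "\<dots> = {0}" using \<open>replicate k 0 \<in> ?V\<close> by (rule image_constant)
  finally show ?thesis by (simp add: multilinear_norm_def)
qed

definition locally_linear_on :: "'a::real_normed_vector set \<Rightarrow> ('a \<Rightarrow> real) \<Rightarrow> bool" where
  "locally_linear_on U f \<longleftrightarrow>
     (\<forall>x\<in>U. \<exists>V h. open V \<and> x \<in> V \<and> V \<subseteq> U \<and> (\<forall>y\<in>V. f y = blinfun_apply h y))"

lemma locally_linear_onE:
  assumes "locally_linear_on U f" and "x \<in> U"
  obtains V h where "open V" "x \<in> V" "V \<subseteq> U" "\<And>y. y \<in> V \<Longrightarrow> f y = blinfun_apply h y"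
  using assms unfolding locally_linear_on_def by metis

lemma locally_linear_imp_LFC:
  assumes "locally_linear_on U f"
  shows "LFC_on U f"
  unfolding LFC_on_def
proof
  fix x assume "x \<in> U"
  with assms obtain V h where V: "open V" "x \<in> V" "V \<subseteq> U"
      and eq: "\<And>y. y \<in> V \<Longrightarrow> f y = blinfun_apply h y"
    by (rule locally_linear_onE) (rule that)
  have "\<exists>\<Psi> :: ('a \<Rightarrow>\<^sub>L real) set. finite \<Psi> \<and>
      (\<forall>y\<in>V. \<forall>z\<in>V. (\<forall>\<psi>\<in>\<Psi>. blinfun_apply \<psi> y = blinfun_apply \<psi> z) \<longrightarrow> f y = f z)"
    by (intro exI[of _ "{h}"] conjI) (simp_all add: eq)
  with V show "\<exists>V. open V \<and> x \<in> V \<and> V \<subseteq> U \<and> (\<exists>\<Psi> :: ('a \<Rightarrow>\<^sub>L real) set. finite \<Psi> \<and>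
      (\<forall>y\<in>V. \<forall>z\<in>V. (\<forall>\<psi>\<in>\<Psi>. blinfun_apply \<psi> y = blinfun_apply \<psi> z) \<longrightarrow> f y = f z))"
    by blast
qed

text \<open>
  Used to see that the functional representing a locally linear function is locally constant in the
  base point, which makes the higher derivatives vanish.
\<close>

lemma blinfun_eq_if_eq_on_open:
  fixes g h :: "'a::real_normed_vector \<Rightarrow>\<^sub>L 'b::real_normed_vector"
  assumes V: "open V" "x \<in> V" and eq: "\<And>y. y \<in> V \<Longrightarrow> blinfun_apply g y = blinfun_apply h y"
  shows "g = h"
proof (rule blinfun_eqI)
  fix v
  have "((\<lambda>t. x + t *\<^sub>R v) \<longlongrightarrow> x + 0 *\<^sub>R v) (at_right 0)"
    by (intro tendsto_intros)
  then have "\<forall>\<^sub>F t in at_right (0::real). x + t *\<^sub>R v \<in> V"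
    using V by (auto simp: tendsto_def)
  then have "\<forall>\<^sub>F t in at_right (0::real). 0 < t \<and> x + t *\<^sub>R v \<in> V"
    by (intro eventually_conj eventually_at_right_less)
  then obtain t :: real where t: "0 < t" "x + t *\<^sub>R v \<in> V"
    using eventually_happens[of _ "at_right (0::real)"] by auto
  have "t *\<^sub>R blinfun_apply g v = t *\<^sub>R blinfun_apply h v"
    using eq[OF t(2)] eq[OF V(2)] by (simp add: blinfun.add_right blinfun.scaleR_right)
  then show "blinfun_apply g v = blinfun_apply h v" using t by simp
qed

text \<open>
  Near \<open>x\<close>, the derivatives of \<open>f\<close> are \<open>f\<close> itself, the constant \<open>L x\<close>, and \<open>0\<close> from the second order
  on.  All differences in the definition of smoothness then vanish identically near \<open>x\<close>, except the
  one that expresses continuity of \<open>f\<close>.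
\<close>

lemma locally_linear_imp_C_infinity:
  assumes "locally_linear_on U f"
  shows "C_infinity_on U f"
proof -
  define germ where "germ x h \<longleftrightarrow>
      (\<exists>V. open V \<and> x \<in> V \<and> V \<subseteq> U \<and> (\<forall>y\<in>V. f y = blinfun_apply h y))" for x h
  define L where "L x = (SOME h. germ x h)" for x
  define D where "D k x vs = (if k = 0 then f x else if k = 1 then blinfun_apply (L x) (hd vs) else 0)"
    for k :: nat and x vs
  have germ_L: "germ x (L x)" if "x \<in> U" for x
  proof -
    have "\<exists>h. germ x h" using assms that unfolding locally_linear_on_def germ_def by blast
    then show ?thesis unfolding L_def by (rule someI_ex)
  qed
  have near: "\<forall>\<^sub>F y in at x. f y = blinfun_apply (L x) y \<and> L y = L x" if x: "x \<in> U" for x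
  proof -
    obtain V where V: "open V" "x \<in> V" "V \<subseteq> U" "\<forall>y\<in>V. f y = blinfun_apply (L x) y"
      using germ_L[OF x] unfolding germ_def by blast
    have "L y = L x" if y: "y \<in> V" for y
    proof -
      obtain W where W: "open W" "y \<in> W" "\<forall>z\<in>W. f z = blinfun_apply (L y) z"
        using germ_L y V(3) unfolding germ_def by blast
      show ?thesis
        using V W y by (intro blinfun_eq_if_eq_on_open[of "V \<inter> W" y]) auto
    qed
    then have "\<forall>y\<in>V. f y = blinfun_apply (L x) y \<and> L y = L x" using V(4) by blast
    then show ?thesis unfolding eventually_at_topological using V(1,2) by blast
  qed
  have fx: "f x = blinfun_apply (L x) x" if "x \<in> U" for x
    using germ_L[OF that] unfolding germ_def by blast
  show ?thesis
    unfolding C_infinity_on_def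
  proof (intro exI[of _ D] conjI ballI allI)
    fix x assume "x \<in> U"
    show "D 0 x [] = f x" by (simp add: D_def)
  next
    fix k x assume x: "x \<in> U"
    show "bounded_multilinear k (D k x)"
      unfolding bounded_multilinear_def
    proof (intro conjI allI impI)
      fix us vs :: "'a list" assume "length us + Suc (length vs) = k"
      then show "linear (\<lambda>v. D k x (us @ v # vs))"
        by (cases us) (auto simp: D_def linear_iff blinfun.add_right blinfun.scaleR_right)
    next
      have "norm (D k x vs) \<le> (\<bar>f x\<bar> + norm (L x)) * prod_list (map norm vs)"
        if len: "length vs = k" for vs
      proof -
        have nn: "0 \<le> prod_list (map norm ws)" for ws :: "'a list" by (induction ws) auto
        consider "k = 0" | "k = 1" | "k > 1" by linarith
        then show ?thesis
        proof cases
          case 2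
          then obtain v where v: "vs = [v]" using len by (auto simp: length_Suc_conv)
          have "norm (L x) * norm v \<le> (\<bar>f x\<bar> + norm (L x)) * norm v"
            by (intro mult_right_mono) auto
          with norm_blinfun[of "L x" v] show ?thesis using 2 v by (simp add: D_def)
        qed (use that nn in \<open>auto simp: D_def\<close>)
      qed
      then show "\<exists>K. \<forall>vs. length vs = k \<longrightarrow> norm (D k x vs) \<le> K * prod_list (map norm vs)" by blast
    qed
    have cont: "((\<lambda>y. blinfun_apply (L x) y) \<longlongrightarrow> f x) (at x)"
      unfolding fx[OF x] by (intro tendsto_intros)
    have "(f \<longlongrightarrow> f x) (at x)"
      by (rule Lim_transform_eventually[OF cont]) (use near[OF x] in \<open>auto elim: eventually_mono\<close>)
    then have "((\<lambda>y. norm (f y - f x)) \<longlongrightarrow> 0) (at x)"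
      by (intro tendsto_norm_zero LIM_zero)
    moreover have "multilinear_norm 0 (\<lambda>vs. D 0 y vs - D 0 x vs) = norm (f y - f x)" for y
      by (simp add: multilinear_norm_def D_def Collect_conv_if conj_commute)
    moreover have "\<forall>\<^sub>F y in at x. 0 = multilinear_norm k (\<lambda>vs. D k y vs - D k x vs)" if "k \<noteq> 0"
      using near[OF x]
    proof eventually_elim
      case (elim y)
      then show ?case
        using that by (intro multilinear_norm_zero[symmetric]) (auto simp: D_def)
    qed
    ultimately show "((\<lambda>y. multilinear_norm k (\<lambda>vs. D k y vs - D k x vs)) \<longlongrightarrow> 0) (at x)"
      by (cases "k = 0") (auto intro: Lim_transform_eventually[OF tendsto_const])
    have "\<forall>\<^sub>F y in at x. 0 =
        multilinear_norm k (\<lambda>vs. D k y vs - D k x vs - D (Suc k) x ((y - x) # vs)) / norm (y - x)"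
      using near[OF x]
    proof eventually_elim
      case (elim y)
      have "multilinear_norm k (\<lambda>vs. D k y vs - D k x vs - D (Suc k) x ((y - x) # vs)) = 0"
        using elim fx[OF x] by (intro multilinear_norm_zero) (auto simp: D_def blinfun.diff_right)
      then show ?case by simp
    qed
    then show "((\<lambda>y. multilinear_norm k (\<lambda>vs. D k y vs - D k x vs - D (Suc k) x ((y - x) # vs))
        / norm (y - x)) \<longlongrightarrow> 0) (at x)"
      by (rule Lim_transform_eventually[OF tendsto_const])
  qed
qed

section \<open>Seminorms and equivalent norms\<close>

definition seminorm :: "('a::real_vector \<Rightarrow> real) \<Rightarrow> bool" where
  "seminorm p \<longleftrightarrow> (\<forall>c x. p (c *\<^sub>R x) = \<bar>c\<bar> * p x) \<and> (\<forall>x y. p (x + y) \<le> p x + p y)"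

lemma seminormI:
  assumes "\<And>c x. p (c *\<^sub>R x) = \<bar>c\<bar> * p x" and "\<And>x y. p (x + y) \<le> p x + p y"
  shows "seminorm p"
  using assms by (simp add: seminorm_def)

lemma seminorm_scale: "seminorm p \<Longrightarrow> p (c *\<^sub>R x) = \<bar>c\<bar> * p x"
  and seminorm_triangle: "seminorm p \<Longrightarrow> p (x + y) \<le> p x + p y"
  by (auto simp: seminorm_def)

lemma seminorm_uminus: "seminorm p \<Longrightarrow> p (- x) = p x"
  using seminorm_scale[of p "-1" x] by simp

lemma seminorm_zero: "seminorm p \<Longrightarrow> p 0 = 0"
  using seminorm_scale[of p 0 0] by simp

lemma seminorm_nonneg: "seminorm p \<Longrightarrow> 0 \<le> p x"
  using seminorm_triangle[of p x "- x"] seminorm_uminus[of p x] seminorm_zero[of p] by simp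

lemma seminorm_diff_le: "seminorm p \<Longrightarrow> \<bar>p x - p y\<bar> \<le> p (x - y)"
  using seminorm_triangle[of p "x - y" y] seminorm_triangle[of p "y - x" x]
    seminorm_uminus[of p "x - y"] by simp

lemma seminorm_sublinear: "seminorm p \<Longrightarrow> sublinear p"
  by (simp add: seminorm_def sublinear_def)

lemma seminorm_add:
  assumes p: "seminorm p" and q: "seminorm q"
  shows "seminorm (\<lambda>x. p x + q x)"
proof (rule seminormI)
  fix x y
  show "p (x + y) + q (x + y) \<le> p x + q x + (p y + q y)"
    using seminorm_triangle[OF p, of x y] seminorm_triangle[OF q, of x y] by simp
qed (simp add: seminorm_scale p q algebra_simps)

lemma seminorm_cmult:
  assumes p: "seminorm p" and c: "0 \<le> c"
  shows "seminorm (\<lambda>x. c * p x)"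
proof (rule seminormI)
  fix x y
  show "c * p (x + y) \<le> c * p x + c * p y"
    using mult_left_mono[OF seminorm_triangle[OF p] c] by (simp add: algebra_simps)
qed (simp add: seminorm_scale p)

lemma seminorm_SUP:
  fixes p :: "'i \<Rightarrow> 'a::real_vector \<Rightarrow> real"
  assumes ne: "I \<noteq> {}" and p: "\<And>i. i \<in> I \<Longrightarrow> seminorm (p i)"
    and bound: "\<And>i x. i \<in> I \<Longrightarrow> p i x \<le> B x"
  shows "seminorm (\<lambda>x. SUP i\<in>I. p i x)"
proof -
  let ?s = "\<lambda>x. SUP i\<in>I. p i x"
  have upper: "p i x \<le> ?s x" if "i \<in> I" for i x
    by (rule cSUP_upper[OF that]) (auto intro!: bdd_aboveI2 bound)
  have least: "?s x \<le> b" if "\<And>i. i \<in> I \<Longrightarrow> p i x \<le> b" for x b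
    using ne that by (rule cSUP_least)
  have scale_le: "?s (c *\<^sub>R x) \<le> \<bar>c\<bar> * ?s x" for c x
    by (rule least) (simp add: seminorm_scale[OF p] mult_left_mono upper)
  show ?thesis
  proof (rule seminormI)
    fix c x
    show "?s (c *\<^sub>R x) = \<bar>c\<bar> * ?s x"
    proof (cases "c = 0")
      case True
      have "(\<lambda>i. p i 0) ` I = (\<lambda>_. 0) ` I"
        by (intro image_cong refl) (simp add: seminorm_zero p)
      then have "?s 0 = 0" using ne by simp
      with True show ?thesis by simp
    next
      case False
      have "?s ((1 / c) *\<^sub>R c *\<^sub>R x) \<le> \<bar>1 / c\<bar> * ?s (c *\<^sub>R x)" by (rule scale_le)
      then have "\<bar>c\<bar> * ?s x \<le> ?s (c *\<^sub>R x)"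
        using False by (simp add: field_simps abs_divide)
      with scale_le[of c x] show ?thesis by simp
    qed
  next
    fix x y
    show "?s (x + y) \<le> ?s x + ?s y"
    proof (rule least)
      fix i assume i: "i \<in> I"
      have "p i (x + y) \<le> p i x + p i y" by (rule seminorm_triangle[OF p[OF i]])
      also have "\<dots> \<le> ?s x + ?s y" using i by (intro add_mono upper)
      finally show "p i (x + y) \<le> ?s x + ?s y" .
    qed
  qed
qed

lemma is_norm_iff: "is_norm p \<longleftrightarrow> seminorm p \<and> (\<forall>x. p x = 0 \<longrightarrow> x = 0)"
  using seminorm_nonneg[of p] seminorm_zero[of p] unfolding is_norm_def seminorm_def by blast

lemma equivalent_norm_seminorm: "equivalent_norm p \<Longrightarrow> seminorm p"
  by (simp add: equivalent_norm_def is_norm_iff)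

lemma equivalent_norm_bounds:
  assumes "equivalent_norm p"
  obtains a b where "0 < a" "0 < b" "\<And>x. a * norm x \<le> p x" "\<And>x. p x \<le> b * norm x"
  using assms unfolding equivalent_norm_def by metis

lemma equivalent_norm_positive:
  assumes "equivalent_norm p" and "x \<noteq> 0"
  shows "0 < p x"
proof -
  have "0 \<le> p x" "p x \<noteq> 0" using assms by (auto simp: equivalent_norm_def is_norm_def)
  then show ?thesis by simp
qed

lemma equivalent_norm_between:
  assumes p: "equivalent_norm p" and q: "seminorm q"
    and lower: "\<And>x. p x \<le> q x" and upper: "\<And>x. q x \<le> c * p x"
  shows "equivalent_norm q"
proof -
  obtain a b where ab: "0 < a" "0 < b" "\<And>x. a * norm x \<le> p x" "\<And>x. p x \<le> b * norm x"
    by (rule equivalent_norm_bounds[OF p]) (rule that)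
  have a: "a * norm x \<le> q x" for x using ab(3) lower order_trans by blast
  have b: "q x \<le> (max c 1 * b) * norm x" for x
  proof -
    have "q x \<le> max c 1 * p x"
      using upper[of x] seminorm_nonneg[OF equivalent_norm_seminorm[OF p], of x]
      by (meson max.cobounded1 mult_right_mono order_trans)
    also have "\<dots> \<le> max c 1 * (b * norm x)" using ab(4) by (intro mult_left_mono) auto
    finally show ?thesis by (simp add: mult.assoc)
  qed
  have "x = 0" if "q x = 0" for x
    using a[of x] that ab(1) by (simp add: mult_le_0_iff)
  then have "is_norm q" using q by (simp add: is_norm_iff)
  moreover have "0 < max c 1 * b" using ab(2) by simp
  ultimately show ?thesis unfolding equivalent_norm_def using a b ab(1) by blast
qed

lemma equivalent_norm_continuous:
  assumes "equivalent_norm p"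
  shows "continuous_on UNIV p"
proof -
  obtain a b where ab: "0 < a" "0 < b" "\<And>x. a * norm x \<le> p x" "\<And>x. p x \<le> b * norm x"
    by (rule equivalent_norm_bounds[OF assms]) (rule that)
  have "dist (p x) (p y) \<le> b * dist x y" for x y
    using seminorm_diff_le[OF equivalent_norm_seminorm[OF assms], of x y] ab(4)[of "x - y"]
    by (simp add: dist_norm)
  then have "b-lipschitz_on UNIV p"
    using ab(2) by (intro lipschitz_onI) auto
  then show ?thesis by (rule lipschitz_on_continuous_on)
qed

section \<open>Cutting off caps\<close>

definition excess_cone :: "('a::real_normed_vector \<Rightarrow> real) \<Rightarrow> ('a \<Rightarrow>\<^sub>L real) \<Rightarrow> 'a set" where
  "excess_cone p h = {x. p x < \<bar>blinfun_apply h x\<bar>}"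

text \<open>
  Take a maximal family \<open>H\<close> of functionals with pairwise disjoint cones.  On the cone of
  \<open>h \<in> H\<close> every other member of \<open>H\<close> is at most \<open>p\<close>, so the supremum of \<open>p\<close> and all \<open>\<bar>h\<bar>\<close>
  is \<open>\<bar>h\<bar>\<close> there.  If the union of the cones missed an open set \<open>W\<close>, a functional whose cone lies in
  the cone over \<open>W\<close> could be added to \<open>H\<close>, because the cones of \<open>H\<close> are invariant under nonzero
  scaling.
\<close>

lemma locally_linear_norm_if_small_excess_cones:
  fixes p :: "'a::real_normed_vector \<Rightarrow> real"
  assumes p: "equivalent_norm p" and \<kappa>: "0 \<le> \<kappa>"
    and small: "\<And>W. open W \<Longrightarrow> W \<noteq> {} \<Longrightarrow> \<exists>h :: 'a \<Rightarrow>\<^sub>L real. (\<forall>x. blinfun_apply h x \<le> (1 + \<kappa>) * p x) \<and>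
        (\<exists>y\<in>W. p y < blinfun_apply h y) \<and> (\<forall>x. p x < blinfun_apply h x \<longrightarrow> (\<exists>t>0. t *\<^sub>R x \<in> W))"
  obtains q U where "equivalent_norm q" "\<And>x. p x \<le> q x" "\<And>x. q x \<le> (1 + \<kappa>) * p x"
    "open U" "closure U = UNIV" "locally_linear_on U q"
proof -
  note sp = equivalent_norm_seminorm[OF p]
  have p0: "0 \<le> p x" for x by (rule seminorm_nonneg[OF sp])
  define \<A> where "\<A> = {H. (\<forall>h\<in>H. \<forall>x. \<bar>blinfun_apply h x\<bar> \<le> (1 + \<kappa>) * p x) \<and>
      pairwise (\<lambda>g h. excess_cone p g \<inter> excess_cone p h = {}) H}"
  have "\<exists>H\<in>\<A>. \<forall>X\<in>\<A>. H \<subseteq> X \<longrightarrow> X = H"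
  proof (rule subset_Zorn')
    fix C assume C: "subset.chain \<A> C"
    then have "chain\<^sub>\<subseteq> C" "C \<subseteq> \<A>" by (auto simp: subset_chain_def chain_subset_def)
    then have "pairwise (\<lambda>g h. excess_cone p g \<inter> excess_cone p h = {}) (\<Union>C)"
      by (intro pairwise_chain_Union) (auto simp: \<A>_def)
    with \<open>C \<subseteq> \<A>\<close> show "\<Union>C \<in> \<A>" by (auto simp: \<A>_def)
  qed
  then obtain H where H: "H \<in> \<A>" and maximal: "\<And>X. X \<in> \<A> \<Longrightarrow> H \<subseteq> X \<Longrightarrow> X = H"
    by blast
  have H_bound: "\<bar>blinfun_apply h x\<bar> \<le> (1 + \<kappa>) * p x" if "h \<in> H" for h x
    using H that by (auto simp: \<A>_def)
  have H_disj: "excess_cone p g \<inter> excess_cone p h = {}" if "g \<in> H" "h \<in> H" "g \<noteq> h" for g h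
    using H that by (auto simp: \<A>_def pairwise_def)
  define U where "U = (\<Union>h\<in>H. excess_cone p h)"
  \<comment> \<open>The zero functional has an empty cone; it only makes the index set nonempty.\<close>
  define q where "q x = (SUP h\<in>insert 0 H. max (p x) \<bar>blinfun_apply h x\<bar>)" for x
  have open_cone: "open (excess_cone p h)" for h
    unfolding excess_cone_def
    by (intro open_Collect_less continuous_intros equivalent_norm_continuous[OF p])
  have term_bound: "max (p x) \<bar>blinfun_apply h x\<bar> \<le> (1 + \<kappa>) * p x" if "h \<in> insert 0 H" for h x
  proof -
    have "p x \<le> (1 + \<kappa>) * p x" using p0[of x] \<kappa> by (simp add: algebra_simps)
    with that p0[of x] \<kappa> H_bound show ?thesis by auto
  qed
  have upper: "max (p x) \<bar>blinfun_apply h x\<bar> \<le> q x" if "h \<in> insert 0 H" for h x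
    unfolding q_def
    by (rule cSUP_upper[OF that]) (auto intro!: bdd_aboveI2[where M = "(1 + \<kappa>) * p x"] simp: term_bound simp del: max.bounded_iff)
  have least: "q x \<le> b" if "\<And>h. h \<in> insert 0 H \<Longrightarrow> max (p x) \<bar>blinfun_apply h x\<bar> \<le> b" for x b
    unfolding q_def by (rule cSUP_least) (use that in auto)
  have "seminorm q"
    unfolding q_def
  proof (rule seminorm_SUP)
    fix h :: "'a \<Rightarrow>\<^sub>L real"
    show "seminorm (\<lambda>x. max (p x) \<bar>blinfun_apply h x\<bar>)"
    proof (rule seminormI)
      fix c x
      show "max (p (c *\<^sub>R x)) \<bar>blinfun_apply h (c *\<^sub>R x)\<bar> = \<bar>c\<bar> * max (p x) \<bar>blinfun_apply h x\<bar>"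
        by (simp add: seminorm_scale[OF sp] blinfun.scaleR_right abs_mult max_mult_distrib_left)
    next
      fix x y
      show "max (p (x + y)) \<bar>blinfun_apply h (x + y)\<bar>
          \<le> max (p x) \<bar>blinfun_apply h x\<bar> + max (p y) \<bar>blinfun_apply h y\<bar>"
        using seminorm_triangle[OF sp, of x y] by (auto simp: blinfun.add_right)
    qed
  qed (simp, rule term_bound)
  moreover have lower: "p x \<le> q x" for x using upper[of 0 x] by simp
  moreover have q_le: "q x \<le> (1 + \<kappa>) * p x" for x using term_bound by (rule least)
  ultimately have "equivalent_norm q" by (intro equivalent_norm_between[OF p])
  moreover have "open U" unfolding U_def using open_cone by blast
  moreover have "closure U = UNIV"
  proof (rule ccontr)
    assume "closure U \<noteq> UNIV"
    define W where "W = - closure U"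
    have W: "open W" "W \<noteq> {}" using \<open>closure U \<noteq> UNIV\<close> by (auto simp: W_def)
    have WU: "w \<notin> U" if "w \<in> W" for w using that closure_subset by (auto simp: W_def)
    obtain h where h_le: "\<And>x. blinfun_apply h x \<le> (1 + \<kappa>) * p x"
      and h_y: "\<exists>y\<in>W. p y < blinfun_apply h y"
      and h_W: "\<And>x. p x < blinfun_apply h x \<Longrightarrow> \<exists>t>0. t *\<^sub>R x \<in> W"
      using small[OF W] by blast
    have abs_h_le: "\<bar>blinfun_apply h x\<bar> \<le> (1 + \<kappa>) * p x" for x
      using h_le[of x] h_le[of "- x"] by (simp add: blinfun.minus_right seminorm_uminus[OF sp])
    have excess_h: "\<exists>t. t \<noteq> 0 \<and> t *\<^sub>R x \<in> W" if x: "x \<in> excess_cone p h" for x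
    proof (cases "p x < blinfun_apply h x")
      case True
      then obtain t where "t > 0" "t *\<^sub>R x \<in> W" using h_W by blast
      then show ?thesis by (intro exI[of _ t]) auto
    next
      case False
      then have "p (- x) < blinfun_apply h (- x)"
        using x by (auto simp: excess_cone_def seminorm_uminus[OF sp] blinfun.minus_right)
      then obtain t where "t > 0" "t *\<^sub>R (- x) \<in> W" using h_W by blast
      then show ?thesis by (intro exI[of _ "- t"]) auto
    qed
    have disj: "excess_cone p g \<inter> excess_cone p h = {}" if "g \<in> H" for g
    proof (rule ccontr)
      assume "excess_cone p g \<inter> excess_cone p h \<noteq> {}"
      then obtain x t where x: "x \<in> excess_cone p g" and t: "t \<noteq> 0" "t *\<^sub>R x \<in> W"
        using excess_h by blast
      have "t *\<^sub>R x \<in> excess_cone p g"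
        using x t(1) by (simp add: excess_cone_def seminorm_scale[OF sp] blinfun.scaleR_right abs_mult)
      with WU t(2) that show False by (auto simp: U_def)
    qed
    have "insert h H \<in> \<A>"
      using H disj abs_h_le by (auto simp: \<A>_def pairwise_insert)
    then have "h \<in> H" using maximal[of "insert h H"] by blast
    moreover obtain y where "y \<in> W" "y \<in> excess_cone p h"
      using h_y by (auto simp: excess_cone_def)
    ultimately show False using WU[of y] by (auto simp: U_def)
  qed
  moreover have "locally_linear_on U q"
    unfolding locally_linear_on_def
  proof
    fix x assume "x \<in> U"
    then obtain h where h: "h \<in> H" "x \<in> excess_cone p h" by (auto simp: U_def)
    have q_h: "q y = \<bar>blinfun_apply h y\<bar>" if y: "y \<in> excess_cone p h" for y
    proof (rule antisym)
      show "\<bar>blinfun_apply h y\<bar> \<le> q y" using upper[of h y] h(1) by simp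
      show "q y \<le> \<bar>blinfun_apply h y\<bar>"
      proof (rule least)
        fix g assume g: "g \<in> insert 0 H"
        have "\<bar>blinfun_apply g y\<bar> \<le> \<bar>blinfun_apply h y\<bar>"
        proof (cases "g = h \<or> g = 0")
          case False
          then have "y \<notin> excess_cone p g" using H_disj[of g h] g h(1) y by blast
          then show ?thesis using y by (auto simp: excess_cone_def)
        qed auto
        then show "max (p y) \<bar>blinfun_apply g y\<bar> \<le> \<bar>blinfun_apply h y\<bar>"
          using y by (auto simp: excess_cone_def)
      qed
    qed
    \<comment> \<open>The cone of \<open>h\<close> has two opposite halves; \<open>g\<close> is \<open>\<bar>h\<bar>\<close> on the half that contains \<open>x\<close>.\<close>
    define g where "g = (if blinfun_apply h x > 0 then h else - h)"
    let ?V = "excess_cone p h \<inter> {y. 0 < blinfun_apply g y}"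
    have "open ?V"
      by (intro open_Int open_cone open_Collect_less continuous_intros)
    moreover have "x \<in> ?V"
      using h(2) p0[of x] by (auto simp: g_def excess_cone_def blinfun.minus_left)
    moreover have "?V \<subseteq> U" using h(1) by (auto simp: U_def)
    moreover have "q y = blinfun_apply g y" if "y \<in> ?V" for y
      using q_h[of y] that by (auto simp: g_def blinfun.minus_left split: if_splits)
    ultimately show "\<exists>V k. open V \<and> x \<in> V \<and> V \<subseteq> U \<and> (\<forall>y\<in>V. q y = blinfun_apply k y)"
      by blast
  qed
  ultimately show thesis using that lower q_le by blast
qed

section \<open>Series of seminorms\<close>

lemma seminorm_suminf:
  assumes u: "\<And>j. seminorm (u j)" and summable: "\<And>x. summable (\<lambda>j. u j x)"
  shows "seminorm (\<lambda>x. \<Sum>j. u j x)"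
proof (rule seminormI)
  fix c x
  have "(\<Sum>j. u j (c *\<^sub>R x)) = (\<Sum>j. \<bar>c\<bar> * u j x)" by (simp add: seminorm_scale[OF u])
  also have "\<dots> = \<bar>c\<bar> * (\<Sum>j. u j x)" by (rule suminf_mult[OF summable])
  finally show "(\<Sum>j. u j (c *\<^sub>R x)) = \<bar>c\<bar> * (\<Sum>j. u j x)" .
next
  fix x y
  have "(\<Sum>j. u j (x + y)) \<le> (\<Sum>j. u j x + u j y)"
    by (intro suminf_le seminorm_triangle[OF u] summable summable_add)
  also have "\<dots> = (\<Sum>j. u j x) + (\<Sum>j. u j y)" by (rule suminf_add[symmetric, OF summable summable])
  finally show "(\<Sum>j. u j (x + y)) \<le> (\<Sum>j. u j x) + (\<Sum>j. u j y)" .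
qed

lemma seminorm_suminf_split:
  fixes u :: "nat \<Rightarrow> 'a::real_vector \<Rightarrow> real"
  assumes u: "\<And>j. seminorm (u j)" and summable: "\<And>x. summable (\<lambda>j. u j x)"
  obtains v where "seminorm v" "\<And>x. (\<Sum>j. u j x) = v x + u k x"
proof -
  let ?v = "\<lambda>j x. if j = k then 0 else u j x"
  have single: "(\<lambda>j. if j = k then u j x else 0) sums u k x" for x by (rule sums_single)
  have v_summable: "summable (\<lambda>j. ?v j x)" for x
  proof -
    have "summable (\<lambda>j. u j x - (if j = k then u j x else 0))"
      by (intro summable_diff summable sums_summable[OF single])
    moreover have "(\<lambda>j. u j x - (if j = k then u j x else 0)) = (\<lambda>j. ?v j x)" by auto
    ultimately show ?thesis by simp
  qed
  have "seminorm (?v j)" for j using u[of j] by (auto simp: seminorm_def)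
  then have "seminorm (\<lambda>x. \<Sum>j. ?v j x)" using v_summable by (rule seminorm_suminf)
  moreover have "(\<Sum>j. u j x) = (\<Sum>j. ?v j x) + u k x" for x
  proof -
    have "(\<lambda>j. ?v j x + (if j = k then u j x else 0)) sums ((\<Sum>j. ?v j x) + u k x)"
      by (intro sums_add summable_sums v_summable single)
    moreover have "(\<lambda>j. ?v j x + (if j = k then u j x else 0)) = (\<lambda>j. u j x)" by auto
    ultimately show ?thesis by (simp add: sums_iff)
  qed
  ultimately show thesis by (rule that)
qed

section \<open>A seminorm that exposes finitely supported vectors\<close>

lemma seminorm_L2_set:
  fixes \<phi> :: "'i \<Rightarrow> 'a::real_normed_vector \<Rightarrow>\<^sub>L real"
  shows "seminorm (\<lambda>x. L2_set (\<lambda>\<alpha>. blinfun_apply (\<phi> \<alpha>) x) A)"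
proof (rule seminormI)
  fix c x
  have "L2_set (\<lambda>\<alpha>. blinfun_apply (\<phi> \<alpha>) (c *\<^sub>R x)) A = sqrt (c\<^sup>2 * (\<Sum>\<alpha>\<in>A. (blinfun_apply (\<phi> \<alpha>) x)\<^sup>2))"
    by (simp add: L2_set_def blinfun.scaleR_right power_mult_distrib sum_distrib_left)
  then show "L2_set (\<lambda>\<alpha>. blinfun_apply (\<phi> \<alpha>) (c *\<^sub>R x)) A = \<bar>c\<bar> * L2_set (\<lambda>\<alpha>. blinfun_apply (\<phi> \<alpha>) x) A"
    by (simp add: L2_set_def real_sqrt_mult)
next
  fix x y
  show "L2_set (\<lambda>\<alpha>. blinfun_apply (\<phi> \<alpha>) (x + y)) A
      \<le> L2_set (\<lambda>\<alpha>. blinfun_apply (\<phi> \<alpha>) x) A + L2_set (\<lambda>\<alpha>. blinfun_apply (\<phi> \<alpha>) y) A"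
    using L2_set_triangle_ineq by (simp add: blinfun.add_right)
qed

locale unit_biorthogonal =
  fixes \<Gamma> :: "'i set" and e :: "'i \<Rightarrow> 'a::real_normed_vector" and \<phi> :: "'i \<Rightarrow> 'a \<Rightarrow>\<^sub>L real"
  assumes biorthogonal:
      "\<And>\<alpha> \<beta>. \<alpha> \<in> \<Gamma> \<Longrightarrow> \<beta> \<in> \<Gamma> \<Longrightarrow> blinfun_apply (\<phi> \<alpha>) (e \<beta>) = (if \<alpha> = \<beta> then 1 else 0)"
    and norm_functional: "\<And>\<alpha>. \<alpha> \<in> \<Gamma> \<Longrightarrow> norm (\<phi> \<alpha>) \<le> 1"
begin

abbreviation coord :: "'i \<Rightarrow> 'a \<Rightarrow> real" where
  "coord \<alpha> x \<equiv> blinfun_apply (\<phi> \<alpha>) x"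

definition proj :: "'i set \<Rightarrow> 'a \<Rightarrow> 'a" where
  "proj A x = (\<Sum>\<alpha>\<in>A. coord \<alpha> x *\<^sub>R e \<alpha>)"

text \<open>
  The weight of the residual has two jobs.  Dividing by \<open>1 + (\<Sum>\<alpha>\<in>A. \<parallel>e\<^sub>\<alpha>\<parallel>)\<close>, a bound for the
  operator norm of \<open>x \<mapsto> x - P\<^sub>A x\<close>, makes the layers bounded uniformly in \<open>A\<close> although the vectors
  \<open>e\<^sub>\<alpha>\<close> need not be bounded.  Dividing by \<open>k + 1\<close> lets the residual lose against the Euclidean part
  when \<open>k\<close> is large.
\<close>

definition layer :: "nat \<Rightarrow> 'i set \<Rightarrow> 'a \<Rightarrow> real" where
  "layer k A x = norm (x - proj A x) / ((real k + 1) * (1 + (\<Sum>\<alpha>\<in>A. norm (e \<alpha>))))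
     + L2_set (\<lambda>\<alpha>. coord \<alpha> x) A"

definition small_supports :: "nat \<Rightarrow> 'i set set" where
  "small_supports k = {A. A \<subseteq> \<Gamma> \<and> finite A \<and> card A \<le> k}"

definition envelope :: "nat \<Rightarrow> 'a \<Rightarrow> real" where
  "envelope k x = (SUP A\<in>small_supports k. layer k A x)"

lemma abs_coord_le: "\<alpha> \<in> \<Gamma> \<Longrightarrow> \<bar>coord \<alpha> x\<bar> \<le> norm x"
  using norm_blinfun[of "\<phi> \<alpha>" x] norm_functional[of \<alpha>] mult_right_mono[of "norm (\<phi> \<alpha>)" 1 "norm x"]
  by simp

lemma norm_weight_pos: "0 < (real k + 1) * (1 + (\<Sum>\<alpha>\<in>A. norm (e \<alpha>)))"
proof -
  have "0 < 1 + (\<Sum>\<alpha>\<in>A. norm (e \<alpha>))" by (intro add_pos_nonneg sum_nonneg) auto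
  then show ?thesis by simp
qed

lemma proj_add: "proj A (x + y) = proj A x + proj A y"
  by (simp add: proj_def blinfun.add_right scaleR_add_left sum.distrib)

lemma proj_scaleR: "proj A (c *\<^sub>R x) = c *\<^sub>R proj A x"
  by (simp add: proj_def blinfun.scaleR_right scaleR_sum_right)

lemma residual_le:
  assumes "A \<subseteq> \<Gamma>"
  shows "norm (x - proj A x) / ((real k + 1) * (1 + (\<Sum>\<alpha>\<in>A. norm (e \<alpha>)))) \<le> norm x / (real k + 1)"
proof -
  have "norm (proj A x) \<le> (\<Sum>\<alpha>\<in>A. norm x * norm (e \<alpha>))"
    unfolding proj_def using assms abs_coord_le
    by (intro order_trans[OF norm_sum] sum_mono) (auto intro!: mult_right_mono)
  then have "norm (x - proj A x) \<le> norm x * (1 + (\<Sum>\<alpha>\<in>A. norm (e \<alpha>)))"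
    using norm_triangle_ineq4[of x "proj A x"] by (simp add: sum_distrib_left algebra_simps)
  then have "norm (x - proj A x) / ((real k + 1) * (1 + (\<Sum>\<alpha>\<in>A. norm (e \<alpha>))))
      \<le> (norm x * (1 + (\<Sum>\<alpha>\<in>A. norm (e \<alpha>)))) / ((real k + 1) * (1 + (\<Sum>\<alpha>\<in>A. norm (e \<alpha>))))"
    using norm_weight_pos[of k A] by (intro divide_right_mono) auto
  also have "\<dots> = norm x / (real k + 1)"
    by (rule mult_divide_mult_cancel_right) (use norm_weight_pos[of k A] in auto)
  finally show ?thesis .
qed

lemma seminorm_layer: "seminorm (layer k A)"
proof -
  let ?c = "(real k + 1) * (1 + (\<Sum>\<alpha>\<in>A. norm (e \<alpha>)))"
  have "seminorm (\<lambda>x. norm (x - proj A x))"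
  proof (rule seminormI)
    fix c x
    have "c *\<^sub>R x - proj A (c *\<^sub>R x) = c *\<^sub>R (x - proj A x)"
      by (simp add: proj_scaleR scaleR_diff_right)
    then show "norm (c *\<^sub>R x - proj A (c *\<^sub>R x)) = \<bar>c\<bar> * norm (x - proj A x)" by simp
  next
    fix x y
    show "norm (x + y - proj A (x + y)) \<le> norm (x - proj A x) + norm (y - proj A y)"
      using norm_triangle_ineq[of "x - proj A x" "y - proj A y"] by (simp add: proj_add algebra_simps)
  qed
  then have "seminorm (\<lambda>x. (1 / ?c) * norm (x - proj A x))"
    by (rule seminorm_cmult) (use norm_weight_pos[of k A] in simp)
  then have "seminorm (\<lambda>x. (1 / ?c) * norm (x - proj A x) + L2_set (\<lambda>\<alpha>. coord \<alpha> x) A)"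
    by (rule seminorm_add) (rule seminorm_L2_set)
  moreover have "layer k A = (\<lambda>x. (1 / ?c) * norm (x - proj A x) + L2_set (\<lambda>\<alpha>. coord \<alpha> x) A)"
    by (simp add: layer_def fun_eq_iff)
  ultimately show ?thesis by simp
qed

lemma L2_coord_le:
  assumes "A \<in> small_supports k"
  shows "L2_set (\<lambda>\<alpha>. coord \<alpha> x) A \<le> real k * norm x"
proof -
  have "L2_set (\<lambda>\<alpha>. coord \<alpha> x) A \<le> (\<Sum>\<alpha>\<in>A. \<bar>coord \<alpha> x\<bar>)" by (rule L2_set_le_sum_abs)
  also have "\<dots> \<le> real (card A) * norm x"
    using assms abs_coord_le by (intro sum_bounded_above) (auto simp: small_supports_def)
  also have "\<dots> \<le> real k * norm x"
    using assms by (intro mult_right_mono) (auto simp: small_supports_def)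
  finally show ?thesis .
qed

lemma layer_le:
  assumes "A \<in> small_supports k"
  shows "layer k A x \<le> (real k + 1) * norm x"
proof -
  have "norm x / (real k + 1) \<le> norm x" by (simp add: divide_le_eq mult_le_cancel_left1)
  then show ?thesis
    using residual_le[of A x k] L2_coord_le[OF assms, of x] assms
    unfolding layer_def by (simp add: small_supports_def algebra_simps)
qed

lemma empty_small_support: "{} \<in> small_supports k"
  by (simp add: small_supports_def)

lemma layer_le_envelope: "A \<in> small_supports k \<Longrightarrow> layer k A x \<le> envelope k x"
  unfolding envelope_def by (rule cSUP_upper) (auto intro!: bdd_aboveI2 layer_le)

lemma envelope_le:
  assumes "\<And>A. A \<in> small_supports k \<Longrightarrow> layer k A x \<le> b"
  shows "envelope k x \<le> b"
  unfolding envelope_def using empty_small_support assms by (intro cSUP_least) auto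

lemma seminorm_envelope: "seminorm (envelope k)"
  unfolding envelope_def[abs_def]
  by (rule seminorm_SUP) (use empty_small_support[of k] seminorm_layer layer_le in auto)

lemma finite_support:
  assumes "y \<in> span (e ` \<Gamma>)"
  obtains A where "finite A" "A \<subseteq> \<Gamma>" "\<And>\<alpha>. \<alpha> \<in> \<Gamma> \<Longrightarrow> coord \<alpha> y \<noteq> 0 \<longleftrightarrow> \<alpha> \<in> A" "proj A y = y"
proof -
  obtain S c where S: "finite S" "S \<subseteq> e ` \<Gamma>" and y: "y = (\<Sum>a\<in>S. c a *\<^sub>R a)"
    using assms unfolding span_explicit by blast
  have inj: "inj_on e \<Gamma>"
  proof (rule inj_onI)
    fix \<alpha> \<beta> assume "\<alpha> \<in> \<Gamma>" "\<beta> \<in> \<Gamma>" "e \<alpha> = e \<beta>"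
    then show "\<alpha> = \<beta>"
      using biorthogonal[of \<alpha> \<alpha>] biorthogonal[of \<alpha> \<beta>] by (simp split: if_splits)
  qed
  obtain B where B: "B \<subseteq> \<Gamma>" "S = e ` B" "finite B"
    using finite_subset_image[OF S] by blast
  have "y = (\<Sum>\<beta>\<in>B. c (e \<beta>) *\<^sub>R e \<beta>)"
    unfolding y B(2) using inj_on_subset[OF inj B(1)] by (simp add: sum.reindex)
  then have "coord \<alpha> y = (\<Sum>\<beta>\<in>B. c (e \<beta>) * coord \<alpha> (e \<beta>))" for \<alpha>
    by (simp add: blinfun.sum_right blinfun.scaleR_right)
  also have "(\<Sum>\<beta>\<in>B. c (e \<beta>) * coord \<alpha> (e \<beta>)) = (\<Sum>\<beta>\<in>B. if \<alpha> = \<beta> then c (e \<beta>) else 0)"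
    if "\<alpha> \<in> \<Gamma>" for \<alpha>
    using that B(1) by (intro sum.cong refl) (auto simp: biorthogonal)
  finally have coord_y: "coord \<alpha> y = (if \<alpha> \<in> B then c (e \<alpha>) else 0)" if "\<alpha> \<in> \<Gamma>" for \<alpha>
    using that B(3) by simp
  define A where "A = {\<alpha>\<in>B. coord \<alpha> y \<noteq> 0}"
  have "proj A y = (\<Sum>\<alpha>\<in>B. coord \<alpha> y *\<^sub>R e \<alpha>)"
    unfolding proj_def A_def using B(3) by (intro sum.mono_neutral_left) auto
  also have "\<dots> = (\<Sum>\<alpha>\<in>B. c (e \<alpha>) *\<^sub>R e \<alpha>)"
    using B(1) by (intro sum.cong refl) (auto simp: coord_y)
  also have "\<dots> = y" using \<open>y = (\<Sum>\<beta>\<in>B. c (e \<beta>) *\<^sub>R e \<beta>)\<close> by simp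
  finally have "proj A y = y" .
  moreover have "coord \<alpha> y \<noteq> 0 \<longleftrightarrow> \<alpha> \<in> A" if "\<alpha> \<in> \<Gamma>" for \<alpha>
    using coord_y[OF that] by (auto simp: A_def)
  ultimately show thesis using that[of A] B by (auto simp: A_def)
qed

text \<open>
  A set \<open>B\<close> that contains the support \<open>A\<close> gives the same value as \<open>A\<close>.  A set \<open>B\<close> that misses some
  \<open>\<alpha> \<in> A\<close> has Euclidean part at most \<open>s - gap \<alpha>\<close>, where \<open>s\<close> is the Euclidean norm of all coordinates
  of \<open>y\<close>; the weighted residual of \<open>y\<close> is at most \<open>\<parallel>y\<parallel> / (k + 1)\<close>, and \<open>k\<close> is chosen so large that
  this does not exceed any of the finitely many gaps.
\<close>

lemma envelope_eq_at_support:
  assumes A: "finite A" "A \<subseteq> \<Gamma>" and supp: "\<And>\<alpha>. \<alpha> \<in> \<Gamma> \<Longrightarrow> coord \<alpha> y \<noteq> 0 \<longleftrightarrow> \<alpha> \<in> A"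
    and proj: "proj A y = y" and ne: "A \<noteq> {}"
  obtains k where "card A \<le> k" "envelope k y = L2_set (\<lambda>\<alpha>. coord \<alpha> y) A"
proof -
  define s where "s = L2_set (\<lambda>\<alpha>. coord \<alpha> y) A"
  define gap where "gap \<alpha> = s - sqrt (s\<^sup>2 - (coord \<alpha> y)\<^sup>2)" for \<alpha>
  have s2: "s\<^sup>2 = (\<Sum>\<alpha>\<in>A. (coord \<alpha> y)\<^sup>2)"
    unfolding s_def L2_set_def by (intro real_sqrt_pow2 sum_nonneg) auto
  have "0 < gap \<alpha>" if "\<alpha> \<in> A" for \<alpha>
  proof -
    have "s\<^sup>2 - (coord \<alpha> y)\<^sup>2 < s\<^sup>2" using supp[of \<alpha>] that A by auto
    then have "sqrt (s\<^sup>2 - (coord \<alpha> y)\<^sup>2) < sqrt (s\<^sup>2)" by (rule real_sqrt_less_mono)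
    then show ?thesis by (simp add: gap_def s_def)
  qed
  then have gap_pos: "0 < Min (gap ` A)" using A ne by simp
  obtain m :: nat where m: "norm y / Min (gap ` A) < real m" using reals_Archimedean2 by blast
  define k where "k = max m (card A)"
  have k: "card A \<le> k" "A \<in> small_supports k" using A by (auto simp: k_def small_supports_def)
  have "norm y / Min (gap ` A) \<le> real k + 1" using m by (simp add: k_def)
  then have "norm y / (real k + 1) \<le> Min (gap ` A)"
    using gap_pos by (simp add: field_simps)
  then have k_gap: "norm y / (real k + 1) \<le> gap \<alpha>" if "\<alpha> \<in> A" for \<alpha>
    using that A by (auto intro: order_trans[OF _ Min_le])
  have "envelope k y = s"
  proof (rule antisym)
    have "layer k A y = s" by (simp add: layer_def proj s_def)
    then show "s \<le> envelope k y" using layer_le_envelope[OF k(2)] by metis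
    show "envelope k y \<le> s"
    proof (rule envelope_le)
      fix B assume B: "B \<in> small_supports k"
      then have B': "B \<subseteq> \<Gamma>" "finite B" by (auto simp: small_supports_def)
      have off: "coord \<beta> y = 0" if "\<beta> \<in> B - A" for \<beta> using that B'(1) supp by blast
      show "layer k B y \<le> s"
      proof (cases "A \<subseteq> B")
        case True
        have "proj B y = proj A y"
          unfolding proj_def using True B'(2) off by (intro sum.mono_neutral_right) auto
        moreover have "L2_set (\<lambda>\<alpha>. coord \<alpha> y) B = s"
          unfolding s_def L2_set_def using True B'(2) off
          by (intro arg_cong[of _ _ sqrt] sum.mono_neutral_right) auto
        ultimately show ?thesis by (simp add: layer_def proj)
      next
        case False
        then obtain \<alpha> where \<alpha>: "\<alpha> \<in> A" "\<alpha> \<notin> B" by blast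
        have "(\<Sum>\<beta>\<in>B. (coord \<beta> y)\<^sup>2) = (\<Sum>\<beta>\<in>B \<inter> A. (coord \<beta> y)\<^sup>2)"
          using B'(2) off by (intro sum.mono_neutral_right) auto
        also have "\<dots> \<le> (\<Sum>\<beta>\<in>A - {\<alpha>}. (coord \<beta> y)\<^sup>2)"
          using A(1) \<alpha> by (intro sum_mono2) auto
        also have "\<dots> = s\<^sup>2 - (coord \<alpha> y)\<^sup>2"
          using A(1) \<alpha>(1) by (simp add: s2 sum_diff1)
        finally have "L2_set (\<lambda>\<beta>. coord \<beta> y) B \<le> s - gap \<alpha>"
          by (simp add: L2_set_def gap_def)
        then show ?thesis
          using residual_le[OF B'(1), of y k] k_gap[OF \<alpha>(1)] unfolding layer_def by simp
      qed
    qed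
  qed
  with k(1) show thesis unfolding s_def by (rule that)
qed

text \<open>
  The functional \<open>q\<close> is the inner product with the normalized coordinate vector of \<open>y\<close>.  By the choice
  of \<open>k\<close> it supports the envelope at \<open>y\<close>, and the layer of the support \<open>A\<close> of \<open>y\<close> gives
  \<open>\<parallel>x - P\<^sub>A x\<parallel> / w + (L x - q x) \<le> Q\<^sub>k x - q x\<close> with both summands nonnegative, where \<open>L x\<close> is the
  Euclidean norm of the coordinates in \<open>A\<close>.  When the right-hand side tends to \<open>0\<close>, so do both
  summands.  The second one controls the direction of the coordinate vector, because \<open>v\<close> and
  the unit vector \<open>u\<close> satisfy \<open>\<parallel>v - \<parallel>v\<parallel> u\<parallel>\<^sup>2 = 2 \<parallel>v\<parallel> (\<parallel>v\<parallel> - \<langle>u, v\<rangle>)\<close>.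
\<close>

lemma envelope_exposes_ray:
  assumes y: "y \<in> span (e ` \<Gamma>)" "y \<noteq> 0"
  obtains k q where "linear q" "\<And>x. q x \<le> envelope k x" "q y = envelope k y"
    "\<forall>X K. (\<forall>n. norm (X n) \<le> K) \<longrightarrow> (\<lambda>n. envelope k (X n) - q (X n)) \<longlonglongrightarrow> 0 \<longrightarrow>
       (\<exists>r. (\<forall>n. 0 \<le> r n) \<and> (\<lambda>n. X n - r n *\<^sub>R y) \<longlonglongrightarrow> 0)"
proof -
  obtain A where A: "finite A" "A \<subseteq> \<Gamma>" and supp: "\<And>\<alpha>. \<alpha> \<in> \<Gamma> \<Longrightarrow> coord \<alpha> y \<noteq> 0 \<longleftrightarrow> \<alpha> \<in> A"
    and proj: "proj A y = y"
    using finite_support[OF y(1)] by metis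
  have ne: "A \<noteq> {}" using proj y(2) by (auto simp: proj_def)
  define s where "s = L2_set (\<lambda>\<alpha>. coord \<alpha> y) A"
  obtain k where k: "card A \<le> k" and env_y: "envelope k y = s"
    unfolding s_def by (rule envelope_eq_at_support[OF A supp proj ne])
  have A_small: "A \<in> small_supports k" using A k by (simp add: small_supports_def)
  have s2: "s\<^sup>2 = (\<Sum>\<alpha>\<in>A. (coord \<alpha> y)\<^sup>2)"
    unfolding s_def L2_set_def by (intro real_sqrt_pow2 sum_nonneg) auto
  have s_pos: "0 < s"
  proof -
    have "s \<noteq> 0" using A supp ne by (auto simp: s_def L2_set_eq_0_iff)
    then show ?thesis by (simp add: s_def less_le)
  qed
  define L where "L x = L2_set (\<lambda>\<alpha>. coord \<alpha> x) A" for x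
  have L_nonneg: "0 \<le> L x" for x by (simp add: L_def)
  have L2: "(L x)\<^sup>2 = (\<Sum>\<alpha>\<in>A. (coord \<alpha> x)\<^sup>2)" for x
    unfolding L_def L2_set_def by (intro real_sqrt_pow2 sum_nonneg) auto
  define q where "q x = (\<Sum>\<alpha>\<in>A. coord \<alpha> y * coord \<alpha> x) / s" for x
  have q_L: "q x \<le> L x" for x
  proof -
    have "(\<Sum>\<alpha>\<in>A. coord \<alpha> y * coord \<alpha> x) \<le> (\<Sum>\<alpha>\<in>A. \<bar>coord \<alpha> y\<bar> * \<bar>coord \<alpha> x\<bar>)"
      by (intro sum_mono) (simp add: abs_mult[symmetric])
    also have "\<dots> \<le> s * L x" unfolding s_def L_def by (rule L2_set_mult_ineq)
    finally show ?thesis using s_pos by (simp add: q_def field_simps)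
  qed
  define w where "w = (real k + 1) * (1 + (\<Sum>\<alpha>\<in>A. norm (e \<alpha>)))"
  have w_pos: "0 < w" unfolding w_def by (rule norm_weight_pos)
  have env_ge: "norm (x - proj A x) / w + L x \<le> envelope k x" for x
    using layer_le_envelope[OF A_small, of x] by (simp add: layer_def w_def L_def)
  have "linear q"
    by (simp add: q_def linear_iff blinfun.add_right blinfun.scaleR_right sum.distrib
        add_divide_distrib sum_distrib_left algebra_simps)
  moreover have "q x \<le> envelope k x" for x
  proof -
    have "0 \<le> norm (x - proj A x) / w" using w_pos by simp
    then show ?thesis using env_ge[of x] q_L[of x] by linarith
  qed
  moreover have "q y = envelope k y"
    using s_pos by (simp add: env_y q_def s2[symmetric] power2_eq_square[symmetric])
      (simp add: power2_eq_square)
  moreover have "\<exists>r. (\<forall>n. 0 \<le> r n) \<and> (\<lambda>n. X n - r n *\<^sub>R y) \<longlonglongrightarrow> 0"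
    if X: "\<And>n. norm (X n) \<le> K" and lim: "(\<lambda>n. envelope k (X n) - q (X n)) \<longlonglongrightarrow> 0" for X K
  proof -
    \<comment> \<open>Makes \<open>r n *\<^sub>R y\<close> have a coordinate vector of the same length as that of \<open>X n\<close>.\<close>
    define r where "r n = L (X n) / s" for n
    have res: "(\<lambda>n. X n - proj A (X n)) \<longlonglongrightarrow> 0"
    proof (rule tendsto_norm_zero_cancel)
      have "0 \<le> norm (X n - proj A (X n)) / w \<and>
          norm (X n - proj A (X n)) / w \<le> envelope k (X n) - q (X n)" for n
        using env_ge[of "X n"] q_L[of "X n"] w_pos by auto
      then have "(\<lambda>n. norm (X n - proj A (X n)) / w) \<longlonglongrightarrow> 0"
        by (intro real_tendsto_sandwich[OF _ _ tendsto_const lim]) auto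
      then have "(\<lambda>n. norm (X n - proj A (X n)) / w * w) \<longlonglongrightarrow> 0"
        by (rule tendsto_mult_left_zero)
      then show "(\<lambda>n. norm (X n - proj A (X n))) \<longlonglongrightarrow> 0" using w_pos by simp
    qed
    have comp: "(\<lambda>n. coord \<alpha> (X n) - r n * coord \<alpha> y) \<longlonglongrightarrow> 0" if \<alpha>: "\<alpha> \<in> A" for \<alpha>
    proof -
      have "(coord \<alpha> (X n) - r n * coord \<alpha> y)\<^sup>2 \<le> 2 * (real k * K) * (envelope k (X n) - q (X n))" for n
      proof -
        have "(coord \<alpha> (X n) - r n * coord \<alpha> y)\<^sup>2 \<le> (\<Sum>\<alpha>\<in>A. (coord \<alpha> (X n) - r n * coord \<alpha> y)\<^sup>2)"
          using A(1) \<alpha> by (intro member_le_sum) auto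
        also have "\<dots> = (\<Sum>\<alpha>\<in>A. (coord \<alpha> (X n))\<^sup>2 - 2 * r n * (coord \<alpha> y * coord \<alpha> (X n))
            + (r n)\<^sup>2 * (coord \<alpha> y)\<^sup>2)"
          by (intro sum.cong refl) (simp add: power2_eq_square algebra_simps)
        also have "\<dots> = (L (X n))\<^sup>2 - 2 * r n * (\<Sum>\<alpha>\<in>A. coord \<alpha> y * coord \<alpha> (X n)) + (r n)\<^sup>2 * s\<^sup>2"
          by (simp add: L2 s2 sum.distrib sum_subtractf sum_distrib_left)
        also have "\<dots> = 2 * L (X n) * (L (X n) - q (X n))"
          using s_pos by (simp add: r_def q_def power2_eq_square field_simps)
        also have "\<dots> \<le> 2 * (real k * K) * (envelope k (X n) - q (X n))"
        proof (rule mult_mono)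
          have "L (X n) \<le> real k * norm (X n)" unfolding L_def by (rule L2_coord_le[OF A_small])
          also have "\<dots> \<le> real k * K" using X by (intro mult_left_mono) auto
          finally show "2 * L (X n) \<le> 2 * (real k * K)" by simp
          then show "0 \<le> 2 * (real k * K)" using L_nonneg[of "X n"] by linarith
          have "0 \<le> norm (X n - proj A (X n)) / w" using w_pos by simp
          then show "L (X n) - q (X n) \<le> envelope k (X n) - q (X n)" using env_ge[of "X n"] by linarith
          show "0 \<le> L (X n) - q (X n)" using q_L by simp
        qed
        finally show ?thesis .
      qed
      then have "(\<lambda>n. (coord \<alpha> (X n) - r n * coord \<alpha> y)\<^sup>2) \<longlonglongrightarrow> 0"
        by (intro real_tendsto_sandwich[OF _ _ tendsto_const tendsto_mult_right_zero[OF lim, of "2 * (real k * K)"]]) auto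
      then have "(\<lambda>n. sqrt ((coord \<alpha> (X n) - r n * coord \<alpha> y)\<^sup>2)) \<longlonglongrightarrow> sqrt 0"
        by (rule tendsto_real_sqrt)
      then have "(\<lambda>n. \<bar>coord \<alpha> (X n) - r n * coord \<alpha> y\<bar>) \<longlonglongrightarrow> 0" by simp
      then show ?thesis by (rule tendsto_rabs_zero_cancel)
    qed
    have "(\<lambda>n. (X n - proj A (X n)) + (\<Sum>\<alpha>\<in>A. (coord \<alpha> (X n) - r n * coord \<alpha> y) *\<^sub>R e \<alpha>)) \<longlonglongrightarrow>
        0 + (\<Sum>\<alpha>\<in>A. 0 *\<^sub>R e \<alpha>)"
      by (intro tendsto_intros res comp)
    moreover have "(X n - proj A (X n)) + (\<Sum>\<alpha>\<in>A. (coord \<alpha> (X n) - r n * coord \<alpha> y) *\<^sub>R e \<alpha>)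
        = X n - r n *\<^sub>R y" for n
    proof -
      have "(\<Sum>\<alpha>\<in>A. (coord \<alpha> (X n) - r n * coord \<alpha> y) *\<^sub>R e \<alpha>) = proj A (X n) - r n *\<^sub>R proj A y"
        by (simp add: proj_def scaleR_diff_left sum_subtractf scaleR_sum_right)
      then show ?thesis by (simp add: proj)
    qed
    moreover have "0 \<le> r n" for n using L_nonneg s_pos by (simp add: r_def)
    ultimately show ?thesis by auto
  qed
  ultimately show thesis using that[of q k] by blast
qed

section \<open>Small caps\<close>

text \<open>
  Choose \<open>y \<in> W\<close> in the span and let \<open>g\<close> be a functional supporting \<open>p\<close> at \<open>y\<close>, assembled from the
  exposing functional \<open>q\<close> of some envelope and a support functional of the rest \<open>R\<close> of \<open>p\<close>.  If for
  some \<open>\<sigma> n \<rightarrow> 0\<close> none of the cones \<open>{p < (1 + \<sigma> n) g}\<close> lay in the cone over \<open>W\<close>, points \<open>X n\<close> of these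
  cones without a positive multiple in \<open>W\<close>, scaled to \<open>p (X n) = p y\<close>, would satisfy
  \<open>p (X n) - g (X n) \<rightarrow> 0\<close>.  They would approach the ray through \<open>y\<close>, hence \<open>y\<close> itself by the scaling, and so enter \<open>W\<close>.
\<close>

lemma small_excess_cone:
  fixes p :: "'a \<Rightarrow> real"
  assumes p: "equivalent_norm p"
    and split: "\<And>k. \<exists>c R. 0 < c \<and> seminorm R \<and> (\<forall>x. p x = R x + c * envelope k x)"
    and dense: "closure (span (e ` \<Gamma>)) = UNIV" and nontrivial: "\<exists>x::'a. x \<noteq> 0"
    and \<kappa>: "0 < \<kappa>" and W: "open W" "W \<noteq> {}"
  shows "\<exists>h :: 'a \<Rightarrow>\<^sub>L real. (\<forall>x. blinfun_apply h x \<le> (1 + \<kappa>) * p x) \<and>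
      (\<exists>y\<in>W. p y < blinfun_apply h y) \<and> (\<forall>x. p x < blinfun_apply h x \<longrightarrow> (\<exists>t>0. t *\<^sub>R x \<in> W))"
proof -
  note sp = equivalent_norm_seminorm[OF p]
  have p0: "0 \<le> p x" for x by (rule seminorm_nonneg[OF sp])
  obtain a b where ab: "0 < a" "0 < b" "\<And>x. a * norm x \<le> p x" "\<And>x. p x \<le> b * norm x"
    by (rule equivalent_norm_bounds[OF p]) (rule that)
  have "W \<noteq> {0}"
  proof
    assume "W = {0}"
    obtain v :: 'a where v: "v \<noteq> 0" using nontrivial by blast
    obtain d where d: "0 < d" "ball 0 d \<subseteq> W"
      using W(1) \<open>W = {0}\<close> by (auto simp: open_contains_ball)
    have "(d / (2 * norm v)) *\<^sub>R v \<in> ball 0 d" using v d(1) by simp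
    with d(2) \<open>W = {0}\<close> have "(d / (2 * norm v)) *\<^sub>R v = 0" by blast
    with v d(1) show False by simp
  qed
  then have "W - {0} \<noteq> {}" "open (W - {0})" using W by (auto intro: open_delete)
  then have "(W - {0}) \<inter> span (e ` \<Gamma>) \<noteq> {}"
    using dense open_Int_closure_eq_empty[of "W - {0}" "span (e ` \<Gamma>)"] by auto
  then obtain y where y: "y \<in> W" "y \<noteq> 0" "y \<in> span (e ` \<Gamma>)" by blast
  have py: "0 < p y" by (rule equivalent_norm_positive[OF p y(2)])
  obtain k q where q: "linear q" "\<And>x. q x \<le> envelope k x" "q y = envelope k y"
    and exposes: "\<forall>X K. (\<forall>n. norm (X n) \<le> K) \<longrightarrow> (\<lambda>n. envelope k (X n) - q (X n)) \<longlonglongrightarrow> 0 \<longrightarrow>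
       (\<exists>r. (\<forall>n. 0 \<le> r n) \<and> (\<lambda>n. X n - r n *\<^sub>R y) \<longlonglongrightarrow> 0)"
    by (rule envelope_exposes_ray[OF y(3,2)]) (rule that)
  obtain c R where c: "0 < c" and R: "seminorm R" and p_eq: "\<And>x. p x = R x + c * envelope k x"
    using split[of k] by blast
  obtain f where f: "linear f" "\<And>x. f x \<le> R x" "f y = R y"
    by (rule sublinear_supporting_functional[OF seminorm_sublinear[OF R], of y]) (rule that)
  define g where "g x = f x + c * q x" for x
  have g_lin: "linear g"
    using f(1) q(1) by (simp add: g_def linear_iff algebra_simps)
  have gap: "c * (envelope k x - q x) \<le> p x - g x" for x
    using f(2)[of x] by (simp add: g_def p_eq algebra_simps)
  have g_le: "g x \<le> p x" for x
  proof -
    have "0 \<le> c * (envelope k x - q x)" using c q(2)[of x] by simp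
    then show ?thesis using gap[of x] by linarith
  qed
  have g_y: "g y = p y" by (simp add: g_def p_eq f(3) q(3))
  have g_abs: "\<bar>g x\<bar> \<le> p x" for x
    using g_le[of x] g_le[of "- x"] linear_neg[OF g_lin, of x] seminorm_uminus[OF sp, of x] by simp
  have "bounded_linear g"
    using g_lin g_abs ab(4) order_trans
    by (intro bounded_linear_intro[where K = b]) (auto simp: linear_iff mult.commute, blast)
  then obtain G where G: "\<And>x. blinfun_apply G x = g x"
    using bounded_linear_Blinfun_apply by metis
  define \<sigma> where "\<sigma> n = \<kappa> / (real n + 1)" for n :: nat
  have \<sigma>: "0 < \<sigma> n" "\<sigma> n \<le> \<kappa>" for n
    using \<kappa> by (auto simp: \<sigma>_def divide_le_eq mult_le_cancel_left1)
  have "\<exists>n. \<forall>x. p x < (1 + \<sigma> n) * g x \<longrightarrow> (\<exists>t>0. t *\<^sub>R x \<in> W)"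
  proof (rule ccontr)
    assume "\<not> ?thesis"
    then have "\<forall>n. \<exists>x. p x < (1 + \<sigma> n) * g x \<and> (\<forall>t>0. t *\<^sub>R x \<notin> W)" by blast
    then obtain Z where Z: "\<And>n. p (Z n) < (1 + \<sigma> n) * g (Z n)" "\<And>n t. 0 < t \<Longrightarrow> t *\<^sub>R Z n \<notin> W"
      by metis
    have "Z n \<noteq> 0" for n using Z(1)[of n] linear_0[OF g_lin] p0[of 0] by auto
    then have pZ: "0 < p (Z n)" for n using equivalent_norm_positive[OF p] by blast
    define X where "X n = (p y / p (Z n)) *\<^sub>R Z n" for n
    have pX: "p (X n) = p y" for n
      using pZ[of n] py by (simp add: X_def seminorm_scale[OF sp])
    have XW: "X n \<notin> W" for n unfolding X_def using pZ py by (intro Z(2)) simp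
    have "norm (X n) \<le> p y / a" for n
      using ab(1) ab(3)[of "X n"] pX[of n] by (simp add: field_simps)
    moreover have "(\<lambda>n. envelope k (X n) - q (X n)) \<longlonglongrightarrow> 0"
    proof (rule real_tendsto_sandwich[OF _ _ tendsto_const])
      show "\<forall>\<^sub>F n in sequentially. 0 \<le> envelope k (X n) - q (X n)" using q(2) by simp
      have "envelope k (X n) - q (X n) \<le> (p y / c) * \<sigma> n" for n
      proof -
        have gX: "g (X n) = (p y / p (Z n)) * g (Z n)"
          using linear_scale[OF g_lin] by (simp add: X_def)
        have "p (X n) = (p y / p (Z n)) * p (Z n)" using pZ[of n] pX[of n] by simp
        also have "\<dots> \<le> (p y / p (Z n)) * ((1 + \<sigma> n) * g (Z n))"
          using pZ[of n] py Z(1)[of n] by (intro mult_left_mono) auto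
        also have "\<dots> = (1 + \<sigma> n) * g (X n)" by (simp add: gX mult_ac)
        finally have "p (X n) \<le> (1 + \<sigma> n) * g (X n)" .
        moreover have "\<sigma> n * g (X n) \<le> \<sigma> n * p y"
          using g_le[of "X n"] pX[of n] \<sigma>(1)[of n] by (intro mult_left_mono) auto
        ultimately have "c * (envelope k (X n) - q (X n)) \<le> \<sigma> n * p y"
          using gap[of "X n"] by (simp add: algebra_simps)
        then show ?thesis using c by (simp add: field_simps)
      qed
      then show "\<forall>\<^sub>F n in sequentially. envelope k (X n) - q (X n) \<le> (p y / c) * \<sigma> n" by simp
      have "\<sigma> \<longlonglongrightarrow> 0"
      proof -
        have "(\<lambda>n. \<kappa> * inverse (real (Suc n))) \<longlonglongrightarrow> 0"
          by (rule tendsto_mult_right_zero[OF LIMSEQ_inverse_real_of_nat])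
        moreover have "(\<lambda>n. \<kappa> * inverse (real (Suc n))) = \<sigma>"
          by (simp add: \<sigma>_def fun_eq_iff divide_inverse add.commute)
        ultimately show ?thesis by simp
      qed
      then show "(\<lambda>n. (p y / c) * \<sigma> n) \<longlonglongrightarrow> 0" by (rule tendsto_mult_right_zero)
    qed
    ultimately have "\<exists>r. (\<forall>n. 0 \<le> r n) \<and> (\<lambda>n. X n - r n *\<^sub>R y) \<longlonglongrightarrow> 0"
      using exposes by blast
    then obtain r where r: "\<And>n. 0 \<le> r n" and Xr: "(\<lambda>n. X n - r n *\<^sub>R y) \<longlonglongrightarrow> 0" by blast
    have "(\<lambda>n. p y - r n * p y) \<longlonglongrightarrow> 0"
    proof (rule Lim_null_comparison)
      have "norm (p y - r n * p y) \<le> b * norm (X n - r n *\<^sub>R y)" for n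
        using seminorm_diff_le[OF sp, of "X n" "r n *\<^sub>R y"] ab(4)[of "X n - r n *\<^sub>R y"] r[of n]
        by (simp add: pX seminorm_scale[OF sp])
      then show "\<forall>\<^sub>F n in sequentially. norm (p y - r n * p y) \<le> b * norm (X n - r n *\<^sub>R y)" by simp
      show "(\<lambda>n. b * norm (X n - r n *\<^sub>R y)) \<longlonglongrightarrow> 0"
        by (intro tendsto_mult_right_zero tendsto_norm_zero Xr)
    qed
    then have "(\<lambda>n. 1 - (p y - r n * p y) / p y) \<longlonglongrightarrow> 1 - 0 / p y"
      using py by (intro tendsto_intros) auto
    then have "r \<longlonglongrightarrow> 1" using py by (simp add: diff_divide_distrib)
    then have "(\<lambda>n. (X n - r n *\<^sub>R y) + r n *\<^sub>R y) \<longlonglongrightarrow> 0 + 1 *\<^sub>R y"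
      by (intro tendsto_intros Xr)
    then have "X \<longlonglongrightarrow> y" by simp
    then have "\<forall>\<^sub>F n in sequentially. X n \<in> W" using W(1) y(1) by (rule topological_tendstoD)
    then show False using XW by simp
  qed
  then obtain n where n: "\<And>x. p x < (1 + \<sigma> n) * g x \<Longrightarrow> \<exists>t>0. t *\<^sub>R x \<in> W" by blast
  show ?thesis
  proof (intro exI[of _ "(1 + \<sigma> n) *\<^sub>R G"] conjI allI impI)
    fix x
    have "(1 + \<sigma> n) * g x \<le> (1 + \<sigma> n) * p x" using g_le \<sigma>(1)[of n] by (intro mult_left_mono) auto
    also have "\<dots> \<le> (1 + \<kappa>) * p x" using p0 \<sigma>(2)[of n] by (intro mult_right_mono) auto
    finally show "blinfun_apply ((1 + \<sigma> n) *\<^sub>R G) x \<le> (1 + \<kappa>) * p x"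
      by (simp add: G blinfun.scaleR_left)
    show "\<exists>t>0. t *\<^sub>R x \<in> W" if "p x < blinfun_apply ((1 + \<sigma> n) *\<^sub>R G) x"
      using that by (intro n) (simp add: G blinfun.scaleR_left)
  next
    have "p y < (1 + \<sigma> n) * p y" using py \<sigma>(1)[of n] by (simp add: algebra_simps)
    then show "\<exists>y\<in>W. p y < blinfun_apply ((1 + \<sigma> n) *\<^sub>R G) y"
      using y(1) by (intro bexI[of _ y]) (simp_all add: G blinfun.scaleR_left g_y)
  qed
qed

text \<open>
  Since \<open>Q\<^sub>k\<close> is bounded by \<open>k + 1\<close> times the norm, the weights \<open>c k\<close> make the sum of all terms
  at most \<open>\<kappa> a \<parallel>x\<parallel>\<close>, where \<open>a \<parallel>x\<parallel> \<le> N x\<close>.  As every envelope occurs with a positive weight, each of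
  them can be split off.
\<close>

lemma perturbed_norm:
  fixes N :: "'a \<Rightarrow> real"
  assumes N: "equivalent_norm N" and \<kappa>: "0 < \<kappa>"
  obtains p where "equivalent_norm p" "\<And>x. N x \<le> p x" "\<And>x. p x \<le> (1 + \<kappa>) * N x"
    "\<And>k. \<exists>c R. 0 < c \<and> seminorm R \<and> (\<forall>x. p x = R x + c * envelope k x)"
proof -
  obtain a b where ab: "0 < a" "0 < b" "\<And>x. a * norm x \<le> N x" "\<And>x. N x \<le> b * norm x"
    by (rule equivalent_norm_bounds[OF N]) (rule that)
  define c where "c k = (\<kappa> * a / 2) * (1 / 2) ^ k / (real k + 1)" for k :: nat
  define u where "u k x = c k * envelope k x" for k x
  have c_pos: "0 < c k" for k using \<kappa> ab(1) by (simp add: c_def)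
  have u: "seminorm (u k)" for k
    unfolding u_def[abs_def] using c_pos[of k] by (intro seminorm_cmult seminorm_envelope) simp
  have u_le: "u k x \<le> (\<kappa> * a / 2 * norm x) * (1 / 2) ^ k" for k x
  proof -
    have "envelope k x \<le> (real k + 1) * norm x" by (intro envelope_le layer_le)
    then have "u k x \<le> c k * ((real k + 1) * norm x)"
      unfolding u_def using c_pos[of k] by (intro mult_left_mono) auto
    also have "\<dots> = (\<kappa> * a / 2 * norm x) * (1 / 2) ^ k"
    proof -
      have "real k + 1 \<noteq> 0" by linarith
      then have "c k * (real k + 1) = (\<kappa> * a / 2) * (1 / 2) ^ k"
        unfolding c_def by (rule nonzero_eq_divide_eq[THEN iffD1]) (rule refl)
      then show ?thesis by (simp add: mult.assoc[symmetric]) (simp add: mult_ac)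
    qed
    finally show ?thesis .
  qed
  have geom: "(\<lambda>k. (\<kappa> * a / 2 * norm x) * (1 / 2) ^ k) sums (\<kappa> * a * norm x)" for x
    using sums_mult[OF geometric_sums[of "1 / 2 :: real"], of "\<kappa> * a / 2 * norm x"] by simp
  have summable: "summable (\<lambda>k. u k x)" for x
    by (rule summable_comparison_test'[OF sums_summable[OF geom], of 0])
      (use u_le seminorm_nonneg[OF u] in auto)
  define p where "p x = N x + (\<Sum>k. u k x)" for x
  have p: "seminorm p"
    unfolding p_def[abs_def]
    by (intro seminorm_add seminorm_suminf u summable equivalent_norm_seminorm[OF N])
  have lower: "N x \<le> p x" for x
    unfolding p_def using suminf_nonneg[OF summable] seminorm_nonneg[OF u] by simp
  have upper: "p x \<le> (1 + \<kappa>) * N x" for x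
  proof -
    have "(\<Sum>k. u k x) \<le> \<kappa> * (a * norm x)"
      using suminf_le[OF u_le summable sums_summable[OF geom], of x] sums_unique[OF geom, of x]
      by (simp add: mult.assoc)
    also have "\<dots> \<le> \<kappa> * N x" using ab(3) \<kappa> by (intro mult_left_mono) auto
    finally show ?thesis by (simp add: p_def algebra_simps)
  qed
  have "\<exists>c R. 0 < c \<and> seminorm R \<and> (\<forall>x. p x = R x + c * envelope k x)" for k
  proof -
    obtain v where v: "seminorm v" "\<And>x. (\<Sum>j. u j x) = v x + u k x"
      by (rule seminorm_suminf_split[OF u summable, of k]) (rule that)
    have "seminorm (\<lambda>x. N x + v x)" by (intro seminorm_add v(1) equivalent_norm_seminorm[OF N])
    then show ?thesis
      using c_pos[of k] by (intro exI[of _ "c k"] exI[of _ "\<lambda>x. N x + v x"]) (auto simp: p_def v(2) u_def[of k])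
  qed
  with equivalent_norm_between[OF N p lower upper] lower upper show thesis by (rule that)
qed

end

section \<open>The approximating norm\<close>

lemma unit_biorthogonal_normalize:
  assumes "fundamental_biorthogonal_system \<Gamma> e \<phi>"
  defines "e' \<equiv> \<lambda>\<alpha>. norm (\<phi> \<alpha>) *\<^sub>R e \<alpha>" and "\<phi>' \<equiv> \<lambda>\<alpha>. (1 / norm (\<phi> \<alpha>)) *\<^sub>R \<phi> \<alpha>"
  shows "unit_biorthogonal \<Gamma> e' \<phi>'" and "closure (span (e' ` \<Gamma>)) = UNIV"
proof -
  have bi: "\<And>\<alpha> \<beta>. \<alpha> \<in> \<Gamma> \<Longrightarrow> \<beta> \<in> \<Gamma> \<Longrightarrow> blinfun_apply (\<phi> \<alpha>) (e \<beta>) = (if \<alpha> = \<beta> then 1 else 0)"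
    and dense: "closure (span (e ` \<Gamma>)) = UNIV"
    using assms(1) by (auto simp: fundamental_biorthogonal_system_def biorthogonal_system_def)
  have nz: "\<phi> \<alpha> \<noteq> 0" if "\<alpha> \<in> \<Gamma>" for \<alpha> using bi[OF that that] by auto
  show "unit_biorthogonal \<Gamma> e' \<phi>'"
    by standard (use nz in \<open>auto simp: e'_def \<phi>'_def bi blinfun.scaleR_left blinfun.scaleR_right\<close>)
  have "e \<alpha> \<in> span (e' ` \<Gamma>)" if "\<alpha> \<in> \<Gamma>" for \<alpha>
  proof -
    have "(1 / norm (\<phi> \<alpha>)) *\<^sub>R e' \<alpha> \<in> span (e' ` \<Gamma>)"
      using that by (intro span_scale span_base) simp
    then show ?thesis using nz[OF that] by (simp add: e'_def)
  qed
  then have "span (e ` \<Gamma>) \<subseteq> span (e' ` \<Gamma>)" by (intro span_minimal) auto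
  then have "closure (span (e ` \<Gamma>)) \<subseteq> closure (span (e' ` \<Gamma>))" by (rule closure_mono)
  with dense show "closure (span (e' ` \<Gamma>)) = UNIV" by auto
qed

theorem corollary3p5:
  fixes e :: "'i \<Rightarrow> 'a::banach"
    and \<phi> :: "'i \<Rightarrow> 'a \<Rightarrow>\<^sub>L real"
    and \<Gamma> :: "'i set"
  assumes infinite_dimensional: "\<not> (\<exists>B :: 'a set. finite B \<and> span B = UNIV)"
    and fundamental: "fundamental_biorthogonal_system \<Gamma> e \<phi>"
  shows "\<forall>(N :: 'a \<Rightarrow> real) (\<epsilon> :: real). equivalent_norm N \<and> 0 < \<epsilon> \<longrightarrow>
     (\<exists>(M :: 'a \<Rightarrow> real) (U :: 'a set).
        equivalent_norm M \<and> open U \<and> closure U = UNIV \<and>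
        (\<forall>x. (1 - \<epsilon>) * M x \<le> N x \<and> N x \<le> (1 + \<epsilon>) * M x) \<and>
        C_infinity_on U M \<and> LFC_on U M)"
proof (intro allI impI)
  fix N :: "'a \<Rightarrow> real" and \<epsilon> :: real
  assume "equivalent_norm N \<and> 0 < \<epsilon>"
  then have N: "equivalent_norm N" and \<epsilon>: "0 < \<epsilon>" by auto
  have N0: "0 \<le> N x" for x by (rule seminorm_nonneg[OF equivalent_norm_seminorm[OF N]])
  interpret unit_biorthogonal \<Gamma> "\<lambda>\<alpha>. norm (\<phi> \<alpha>) *\<^sub>R e \<alpha>" "\<lambda>\<alpha>. (1 / norm (\<phi> \<alpha>)) *\<^sub>R \<phi> \<alpha>"
    using fundamental by (rule unit_biorthogonal_normalize)
  have nontrivial: "\<exists>x::'a. x \<noteq> 0"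
  proof (rule ccontr)
    assume "\<not> ?thesis"
    then have "span {} = (UNIV :: 'a set)" by auto
    with infinite_dimensional show False by blast
  qed
  \<comment> \<open>The two steps cost a factor of at most \<open>1 + \<kappa>\<close> each, and \<open>(1 + \<kappa>)\<^sup>2 \<le> 1 + 3 \<kappa>\<close> for \<open>\<kappa> \<le> 1\<close>.\<close>
  define \<kappa> where "\<kappa> = min 1 (\<epsilon> / 3)"
  have \<kappa>: "0 < \<kappa>" using \<epsilon> by (simp add: \<kappa>_def)
  have \<kappa>_\<epsilon>: "(1 + \<kappa>) * (1 + \<kappa>) \<le> 1 + \<epsilon>"
  proof -
    have "\<kappa> * \<kappa> \<le> \<kappa> * 1" using \<kappa> by (intro mult_left_mono) (auto simp: \<kappa>_def)
    moreover have "3 * \<kappa> \<le> \<epsilon>" by (simp add: \<kappa>_def)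
    ultimately show ?thesis by (simp add: algebra_simps)
  qed
  obtain p where p: "equivalent_norm p" and Np: "\<And>x. N x \<le> p x" and pN: "\<And>x. p x \<le> (1 + \<kappa>) * N x"
    and split: "\<And>k. \<exists>c R. 0 < c \<and> seminorm R \<and> (\<forall>x. p x = R x + c * envelope k x)"
    by (rule perturbed_norm[OF N \<kappa>]) (rule that)
  have small: "\<exists>h :: 'a \<Rightarrow>\<^sub>L real. (\<forall>x. blinfun_apply h x \<le> (1 + \<kappa>) * p x) \<and>
      (\<exists>y\<in>W. p y < blinfun_apply h y) \<and> (\<forall>x. p x < blinfun_apply h x \<longrightarrow> (\<exists>t>0. t *\<^sub>R x \<in> W))"
    if "open W" "W \<noteq> {}" for W
    using small_excess_cone[OF p split unit_biorthogonal_normalize(2)[OF fundamental] nontrivial \<kappa> that] .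
  obtain M U where M: "equivalent_norm M" and pM: "\<And>x. p x \<le> M x" and Mp: "\<And>x. M x \<le> (1 + \<kappa>) * p x"
    and U: "open U" "closure U = UNIV" and lin: "locally_linear_on U M"
    by (rule locally_linear_norm_if_small_excess_cones[OF p less_imp_le[OF \<kappa>]])
      (erule (1) small, rule that)
  have "(1 - \<epsilon>) * M x \<le> N x \<and> N x \<le> (1 + \<epsilon>) * M x" for x
  proof
    have M0: "0 \<le> M x" using N0[of x] Np[of x] pM[of x] by linarith
    have "N x \<le> M x" using Np pM by (rule order_trans)
    also have "\<dots> \<le> (1 + \<epsilon>) * M x" using M0 \<epsilon> by (simp add: algebra_simps)
    finally show "N x \<le> (1 + \<epsilon>) * M x" .
    have "M x \<le> (1 + \<kappa>) * ((1 + \<kappa>) * N x)"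
      using \<kappa> by (intro order_trans[OF Mp] mult_left_mono pN) simp
    also have "\<dots> \<le> (1 + \<epsilon>) * N x"
      using mult_right_mono[OF \<kappa>_\<epsilon> N0[of x]] by (simp add: mult.assoc)
    finally have MN: "M x \<le> (1 + \<epsilon>) * N x" .
    show "(1 - \<epsilon>) * M x \<le> N x"
    proof (cases "\<epsilon> \<le> 1")
      case True
      then have "(1 - \<epsilon>) * M x \<le> (1 - \<epsilon>) * ((1 + \<epsilon>) * N x)" using MN by (intro mult_left_mono) auto
      also have "\<dots> = N x - \<epsilon> * \<epsilon> * N x" by (simp add: algebra_simps)
      also have "\<dots> \<le> N x" using N0[of x] by simp
      finally show ?thesis .
    next
      case False
      then have "(1 - \<epsilon>) * M x \<le> 0" using M0 by (intro mult_nonpos_nonneg) auto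
      then show ?thesis using N0[of x] by linarith
    qed
  qed
  with M U locally_linear_imp_C_infinity[OF lin] locally_linear_imp_LFC[OF lin]
  show "\<exists>M U. equivalent_norm M \<and> open U \<and> closure U = UNIV \<and>
      (\<forall>x. (1 - \<epsilon>) * M x \<le> N x \<and> N x \<le> (1 + \<epsilon>) * M x) \<and> C_infinity_on U M \<and> LFC_on U M"
    by blast
qed

end
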